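(* Let $k$ be an integer and let $\left((E^N_t)_N\right)_{t\geq0}$ be a semi-group in $\prod_{N\in\mathbb{N}}\mathbb{C}[\mathcal{P}_k(N)]$ with generator $(H_N)_{N\in\mathbb{N}}$. The semi-group $\left((E^N_t)_N\right)_{t\geq0}$ converges if the sequences $(E_0^N)_{N\in\mathbb{N}}$ and $(H_N)_{N\in\mathbb{N}}$ converge as $N$ goes to infinity. Besides, in that case, for any $t_0\geq0$, $$\frac{d}{dt}\Big|_{t=t_0}\phi_{E_t}^{\kappa}=\phi_H^{\kappa}\boxtimes\phi_{E_{t_0}}^{\kappa},\qquad \frac{d}{dt}\Big|_{t=t_0}\phi_{E_t}^{m}=\phi_H^{\kappa}\boxtimes_d^m\phi_{E_{t_0}}^{m},\qquad \frac{d}{dt}\Big|_{t=t_0}\phi_{E_t}^{m}=\phi_H^{m}\boxtimes_g^m\phi_{E_{t_0}}^{\kappa}.$$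
   Context: $\mathcal{P}_k$ is the set of partitions of $\{1,\dots,k\}\cup\{1',\dots,k'\}$ ($1,\dots,k$ top row, $1',\dots,k'$ bottom row), $\mathrm{id}_k=\{\{i,i'\}:1\le i\le k\}$. $\mathrm{nc}(p)$ is the number of blocks, $p\vee p'$ the finest partition coarser than both, $d(p,p')=\frac12(\mathrm{nc}(p)+\mathrm{nc}(p'))-\mathrm{nc}(p\vee p')$, and $p'\leq p$ if $d(\mathrm{id}_k,p')+d(p',p)=d(\mathrm{id}_k,p)$. Composition: $p\circ p'$ is obtained by putting a diagram of $p'$ above one of $p$, identifying the bottom vertex $i'$ of $p'$ with the top vertex $i$ of $p$, and taking the partition of top and bottom rows induced by the connected components; $\kappa(p,p')$ is the number of connected components entirely contained in the middle row. ${}^tp$ is $p$ with $i$ and $i'$ exchanged for all $i$. The partition algebra $\mathbb{C}[\mathcal{P}_k(N)]$ has basis $\mathcal{P}_k$ and product $p_1p_2=N^{\kappa(p_1,p_2)}(p_1\circ p_2)$; $\mathrm{Tr}_N$ is the linear form with $\mathrm{Tr}_N(p)=N^{\mathrm{nc}(p\vee\mathrm{id}_k)}$. A family $((E_t^N)_N)_{t\geq0}$ of elements of $\prod_N\mathbb{C}[\mathcal{P}_k(N)]$ is a semi-group with generator $(H_N)_N\in\prod_N\mathbb{C}[\mathcal{P}_k(N)]$ if for any $t_0\geq0$ and any $N$, $\frac{d}{dt}|_{t=t_0}E_t^N=H_NE_{t_0}^N$ in $\mathbb{C}[\mathcal{P}_k(N)]$. It converges if for every $t\geq0$ the sequence $(E_t^N)_N$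 converges as $N\to\infty$. For $E\in\mathbb{C}[\mathcal{P}_k(N)]$: $m_p(E)=\frac{1}{\mathrm{Tr}_N(p)}\mathrm{Tr}_N(E\,{}^tp)$ and $\kappa_p(E)=N^{\mathrm{nc}(p)-\mathrm{nc}(p\vee\mathrm{id}_k)}E_p$, $E_p$ being the coordinate of $E$ on $p$. A sequence $(E_N)_N$ converges (in moments) if $m_p(E_N)$ converges for every $p\in\mathcal{P}_k$; then $\kappa_p(E_N)$ converges for every $p$ as well, and $\phi_E^m,\phi_E^\kappa\in(\mathbb{C}[\mathcal{P}_k])^*$ are the linear forms with $\phi_E^m(p)=\lim_Nm_p(E_N)$, $\phi_E^{\kappa}(p)=\lim_N\kappa_p(E_N)$; likewise $\phi^{m}_{E_t},\phi^\kappa_{E_t}$ for $(E_t^N)_N$ and $\phi_H^m,\phi_H^\kappa$ for $(H_N)_N$. Derivatives of linear forms are pointwise. For $p,p'\in\mathcal{P}_k$, $\mathsf{K}_p(p')$ is the set of $p''\in\mathcal{P}_k$ such that $p=p'\circ p''$ and $d(\mathrm{id}_k,p)=d(\mathrm{id}_k,p')+d(\mathrm{id}_k,p'')-\frac{k+\mathrm{nc}(p)-\mathrm{nc}(p')-\mathrm{nc}(p'')}{2}-\kappa(p',p'')$. For $\phi_1,\phi_2\in(\mathbb{C}[\mathcal{P}_k])^*$ and $p\in\mathcal{P}_k$, $$(\phi_1\boxtimes\phi_2)(p)=\sum_{p_1\circ p_2=p,\ p_2\in\mathsf{K}_{p}(p_1)}\phi_1(p_1)\phi_2(p_2),$$ $$(\phi_1\boxtimes_d^m\phi_2)(p)=\sum_{p_1\leq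 p}\phi_1(p_1)\phi_2({}^tp_1\circ p),\qquad (\phi_1\boxtimes_g^m\phi_2)(p)=\sum_{p_1\leq p}\phi_1(p\circ{}^tp_1)\phi_2(p_1).$$ *)

theory Defs
  imports "HOL-Analysis.Analysis" "HOL-Library.Disjoint_Sets"
begin

section \<open>Partitions of two rows of points\<close>

text \<open>The vertex \<open>i\<close> is \<open>(Top, i)\<close> and the vertex \<open>i'\<close> is \<open>(Bot, i)\<close>, with \<open>1 \<le> i \<le> k\<close>. The level
  \<open>Mid\<close> occurs only when two diagrams are stacked.\<close>

datatype level = Top | Mid | Bot

type_synonym vertex = "level \<times> nat"
type_synonym diagram = "vertex set set"

definition verts :: "nat \<Rightarrow> vertex set" where
  "verts k = {Top, Bot} \<times> {1..k}"

definition Parts :: "nat \<Rightarrow> diagram set" where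
  "Parts k = {p. partition_on (verts k) p}"

definition id_part :: "nat \<Rightarrow> diagram" where
  "id_part k = (\<lambda>i. {(Top, i), (Bot, i)}) ` {1..k}"

definition nc :: "diagram \<Rightarrow> nat" where
  "nc p = card p"

text \<open>\<open>refines A p q\<close> says that \<open>p\<close> and \<open>q\<close> are partitions of \<open>A\<close> and that \<open>q\<close> is coarser than \<open>p\<close>.\<close>

definition join_part :: "nat \<Rightarrow> diagram \<Rightarrow> diagram \<Rightarrow> diagram" where
  "join_part k p p' =
     (THE q. refines (verts k) p q \<and> refines (verts k) p' q \<and>
        (\<forall>r. refines (verts k) p r \<and> refines (verts k) p' r \<longrightarrow> refines (verts k) q r))"

definition part_dist :: "nat \<Rightarrow> diagram \<Rightarrow> diagram \<Rightarrow> real" where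
  "part_dist k p p' = (real (nc p) + real (nc p')) / 2 - real (nc (join_part k p p'))"

definition geodesic_le :: "nat \<Rightarrow> diagram \<Rightarrow> diagram \<Rightarrow> bool" where
  "geodesic_le k p' p \<longleftrightarrow>
     part_dist k (id_part k) p' + part_dist k p' p = part_dist k (id_part k) p"

section \<open>Composition and transposition\<close>

definition relabel :: "(level \<Rightarrow> level) \<Rightarrow> diagram \<Rightarrow> diagram" where
  "relabel f p = (\<lambda>b. map_prod f id ` b) ` p"

definition transp :: "diagram \<Rightarrow> diagram" where
  "transp p = relabel (\<lambda>l. case l of Top \<Rightarrow> Bot | Bot \<Rightarrow> Top | Mid \<Rightarrow> Mid) p"

text \<open>Connected components of the graph on \<open>V\<close> in which two vertices are adjacent when some
  member of \<open>F\<close> contains both.\<close>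

definition conn_comps :: "vertex set \<Rightarrow> diagram \<Rightarrow> vertex set set" where
  "conn_comps V F = V // {(x, y). x \<in> V \<and> y \<in> V \<and> (x, y) \<in> (\<Union>b\<in>F. b \<times> b)\<^sup>*}"

text \<open>In \<open>stack k p p'\<close> the diagram \<open>p'\<close> lies above \<open>p\<close>: the bottom row of \<open>p'\<close> and the top row of
  \<open>p\<close> both become the middle row.\<close>

definition stack :: "nat \<Rightarrow> diagram \<Rightarrow> diagram \<Rightarrow> vertex set set" where
  "stack k p p' =
     conn_comps ({Top, Mid, Bot} \<times> {1..k})
       (relabel (\<lambda>l. if l = Bot then Mid else l) p' \<union>
        relabel (\<lambda>l. if l = Top then Mid else l) p)"

definition compose :: "nat \<Rightarrow> diagram \<Rightarrow> diagram \<Rightarrow> diagram" where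
  "compose k p p' = (\<lambda>c. c \<inter> verts k) ` stack k p p' - {{}}"

definition nloops :: "nat \<Rightarrow> diagram \<Rightarrow> diagram \<Rightarrow> nat" where
  "nloops k p p' = card {c \<in> stack k p p'. c \<subseteq> {Mid} \<times> {1..k}}"

section \<open>The partition algebra\<close>

text \<open>An element is given by its coordinates in the basis of partitions, extended by zero to all
  other arguments; convergence and differentiation in this finite-dimensional space are
  coordinatewise.\<close>

type_synonym element = "diagram \<Rightarrow> complex"

definition PAlg :: "nat \<Rightarrow> element set" where
  "PAlg k = {E. \<forall>p. p \<notin> Parts k \<longrightarrow> E p = 0}"

definition basis_elt :: "diagram \<Rightarrow> element" where
  "basis_elt p = (\<lambda>q. if q = p then 1 else 0)"

text \<open>The bilinear extension of \<open>p\<^sub>1 p\<^sub>2 = N\<^bsup>\<kappa>(p\<^sub>1, p\<^sub>2)\<^esup> (p\<^sub>1 \<circ> p\<^sub>2)\<close>.\<close>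

definition palg_mult :: "nat \<Rightarrow> nat \<Rightarrow> element \<Rightarrow> element \<Rightarrow> element" where
  "palg_mult k N E F = (\<lambda>p. \<Sum>p\<^sub>1\<in>Parts k. \<Sum>p\<^sub>2\<in>Parts k.
     E p\<^sub>1 * F p\<^sub>2 * (of_nat N ^ nloops k p\<^sub>1 p\<^sub>2 * basis_elt (compose k p\<^sub>1 p\<^sub>2) p))"

definition Tr :: "nat \<Rightarrow> nat \<Rightarrow> element \<Rightarrow> complex" where
  "Tr k N E = (\<Sum>p\<in>Parts k. E p * of_nat N ^ nc (join_part k p (id_part k)))"

definition moment :: "nat \<Rightarrow> nat \<Rightarrow> diagram \<Rightarrow> element \<Rightarrow> complex" where
  "moment k N p E =
     1 / Tr k N (basis_elt p) * Tr k N (palg_mult k N E (basis_elt (transp p)))"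

definition cumulant :: "nat \<Rightarrow> nat \<Rightarrow> diagram \<Rightarrow> element \<Rightarrow> complex" where
  "cumulant k N p E =
     of_nat N powi (int (nc p) - int (nc (join_part k p (id_part k)))) * E p"

section \<open>Sequences and semi-groups\<close>

text \<open>Sequences are indexed by the integers \<open>N \<ge> 1\<close> (the trace of a partition may vanish for
  \<open>N = 0\<close>); the value at \<open>0\<close> is unconstrained and does not affect limits.\<close>

definition palg_seq :: "nat \<Rightarrow> (nat \<Rightarrow> element) \<Rightarrow> bool" where
  "palg_seq k E \<longleftrightarrow> (\<forall>N\<ge>1. E N \<in> PAlg k)"

definition converges_in_moments :: "nat \<Rightarrow> (nat \<Rightarrow> element) \<Rightarrow> bool" where
  "converges_in_moments k E \<longleftrightarrow> (\<forall>p\<in>Parts k. convergent (\<lambda>N. moment k N p (E N)))"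

text \<open>The derivative at \<open>t\<^sub>0 = 0\<close> is the one-sided one, the family being indexed by \<open>t \<ge> 0\<close>.\<close>

definition semigroup_with_generator ::
    "nat \<Rightarrow> (real \<Rightarrow> nat \<Rightarrow> element) \<Rightarrow> (nat \<Rightarrow> element) \<Rightarrow> bool" where
  "semigroup_with_generator k E H \<longleftrightarrow>
     (\<forall>t\<ge>0. palg_seq k (E t)) \<and> palg_seq k H \<and>
     (\<forall>t\<^sub>0\<ge>0. \<forall>N\<ge>1. \<forall>p\<in>Parts k.
        ((\<lambda>t. E t N p) has_vector_derivative palg_mult k N (H N) (E t\<^sub>0 N) p)
          (at t\<^sub>0 within {0..}))"

definition semigroup_converges :: "nat \<Rightarrow> (real \<Rightarrow> nat \<Rightarrow> element) \<Rightarrow> bool" where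
  "semigroup_converges k E \<longleftrightarrow> (\<forall>t\<ge>0. converges_in_moments k (E t))"

section \<open>Limiting linear forms and their convolutions\<close>

text \<open>A linear form on the span of \<open>Parts k\<close> is given by its values on \<open>Parts k\<close>; its values at
  other arguments are irrelevant.\<close>

type_synonym form = "diagram \<Rightarrow> complex"

definition lim_moment :: "nat \<Rightarrow> (nat \<Rightarrow> element) \<Rightarrow> form" where
  "lim_moment k E = (\<lambda>p. lim (\<lambda>N. moment k N p (E N)))"

definition lim_cumulant :: "nat \<Rightarrow> (nat \<Rightarrow> element) \<Rightarrow> form" where
  "lim_cumulant k E = (\<lambda>p. lim (\<lambda>N. cumulant k N p (E N)))"

definition form_has_derivative ::
    "nat \<Rightarrow> (real \<Rightarrow> form) \<Rightarrow> form \<Rightarrow> real \<Rightarrow> bool" where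
  "form_has_derivative k \<phi> \<psi> t\<^sub>0 \<longleftrightarrow>
     (\<forall>p\<in>Parts k. ((\<lambda>t. \<phi> t p) has_vector_derivative \<psi> p) (at t\<^sub>0 within {0..}))"

definition Kset :: "nat \<Rightarrow> diagram \<Rightarrow> diagram \<Rightarrow> diagram set" where
  "Kset k p p' = {p'' \<in> Parts k. p = compose k p' p'' \<and>
     part_dist k (id_part k) p =
       part_dist k (id_part k) p' + part_dist k (id_part k) p''
       - (real k + real (nc p) - real (nc p') - real (nc p'')) / 2
       - real (nloops k p' p'')}"

definition boxconv :: "nat \<Rightarrow> form \<Rightarrow> form \<Rightarrow> form" where
  "boxconv k \<phi>\<^sub>1 \<phi>\<^sub>2 = (\<lambda>p.
     \<Sum>(p\<^sub>1, p\<^sub>2) \<in> {(p\<^sub>1, p\<^sub>2). p\<^sub>1 \<in> Parts k \<and> p\<^sub>2 \<in> Parts k \<and>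
                          compose k p\<^sub>1 p\<^sub>2 = p \<and> p\<^sub>2 \<in> Kset k p p\<^sub>1}. \<phi>\<^sub>1 p\<^sub>1 * \<phi>\<^sub>2 p\<^sub>2)"

definition boxconv_d :: "nat \<Rightarrow> form \<Rightarrow> form \<Rightarrow> form" where
  "boxconv_d k \<phi>\<^sub>1 \<phi>\<^sub>2 = (\<lambda>p.
     \<Sum>p\<^sub>1 \<in> {p\<^sub>1 \<in> Parts k. geodesic_le k p\<^sub>1 p}. \<phi>\<^sub>1 p\<^sub>1 * \<phi>\<^sub>2 (compose k (transp p\<^sub>1) p))"

definition boxconv_g :: "nat \<Rightarrow> form \<Rightarrow> form \<Rightarrow> form" where
  "boxconv_g k \<phi>\<^sub>1 \<phi>\<^sub>2 = (\<lambda>p.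
     \<Sum>p\<^sub>1 \<in> {p\<^sub>1 \<in> Parts k. geodesic_le k p\<^sub>1 p}. \<phi>\<^sub>1 (compose k p (transp p\<^sub>1)) * \<phi>\<^sub>2 p\<^sub>1)"

end

theory Submission
  imports Defs
begin

text \<open>Expanding in the basis of partitions, moments and cumulants are related by
  \<open>m\<^sub>p(E) = (\<Sum>q. \<kappa>\<^sub>q(E) * N\<^bsup>-\<delta>(q, p)\<^esup>)\<close> and cumulants multiply by
  \<open>\<kappa>\<^sub>p(E F) = (\<Sum>p\<^sub>1 \<circ> p\<^sub>2 = p. \<kappa>\<^bsub>p\<^sub>1\<^esub>(E) * \<kappa>\<^bsub>p\<^sub>2\<^esub>(F) * N\<^bsup>-\<delta>'(p\<^sub>1, p\<^sub>2)\<^esup>)\<close>, with defects \<open>\<delta>, \<delta>' \<ge> 0\<close> by the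
  semimodularity of the partition lattice; they vanish exactly when \<open>q \<le> p\<close>, respectively
  \<open>p\<^sub>2 \<in> K\<^sub>p(p\<^sub>1)\<close>. The limiting passage from cumulants to moments is unitriangular, so
  both kinds of convergence agree. In cumulant coordinates the semi-group solves a linear ODE whose
  matrix converges, so the solutions and their derivatives converge. Rotating the closed diagram of
  \<open>p\<^sub>1 p\<^sub>2 p\<^sup>t\<close> rewrites a moment of a product as a cumulant of one factor times a moment of the
  other, which gives the two moment equations.\<close>

section \<open>Connected components\<close>

text \<open>Block numbers, joins and \<open>nloops\<close> are all numbers of connected components
  of a graph, so the lattice arguments reduce to how a component count reacts to one added edge. At
  finite N the matrices of the product and of the passage from cumulants to moments depend on N.
  Only the limit of the second one is inverted; what remains at finite N is a perturbation with
  vanishing coefficients, absorbed once it is small. Cumulants are the coordinates for the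
  differential equation because their rescaling does not depend on time and leaves only nonpositive
  powers of N in the product. No direct combinatorial identity between the three convolutions is
  needed: the moments of the product of generator and semi-group are expanded in three ways, each
  expansion has a limit, and uniqueness of limits equates them.\<close>

definition linked :: "'a set set \<Rightarrow> ('a \<times> 'a) set" where
  "linked F = (\<Union>b\<in>F. b \<times> b)\<^sup>*"

text \<open>Paths may leave \<open>V\<close>; only the endpoint has to lie in it. Since
  \<open>linked\<close> does not see \<open>V\<close>, it is monotone in the blocks and can be
  shared between different vertex sets.\<close>

definition component :: "'a set \<Rightarrow> 'a set set \<Rightarrow> 'a \<Rightarrow> 'a set" where
  "component V F x = {y \<in> V. (x, y) \<in> linked F}"

definition comps :: "'a set \<Rightarrow> 'a set set \<Rightarrow> 'a set set" where
  "comps V F = component V F ` V"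

abbreviation ncomp :: "'a set \<Rightarrow> 'a set set \<Rightarrow> nat" where
  "ncomp V F \<equiv> card (comps V F)"

lemma linked_refl [simp]: "(x, x) \<in> linked F"
  by (simp add: linked_def)

lemma linked_sym: "(x, y) \<in> linked F \<Longrightarrow> (y, x) \<in> linked F"
proof -
  have "sym (\<Union>b\<in>F. b \<times> b)" by (auto simp: sym_def)
  then show "(x, y) \<in> linked F \<Longrightarrow> (y, x) \<in> linked F"
    unfolding linked_def by (meson sym_rtrancl symD)
qed

lemma linked_trans: "(x, y) \<in> linked F \<Longrightarrow> (y, z) \<in> linked F \<Longrightarrow> (x, z) \<in> linked F"
  by (simp add: linked_def)

lemma linked_eq_left: "(x, y) \<in> linked F \<Longrightarrow> (x, z) \<in> linked F \<longleftrightarrow> (y, z) \<in> linked F"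
  by (metis linked_sym linked_trans)

lemma linked_eq_right: "(x, y) \<in> linked F \<Longrightarrow> (z, x) \<in> linked F \<longleftrightarrow> (z, y) \<in> linked F"
  by (metis linked_sym linked_trans)

lemma linked_block: "b \<in> F \<Longrightarrow> x \<in> b \<Longrightarrow> y \<in> b \<Longrightarrow> (x, y) \<in> linked F"
  unfolding linked_def by blast

lemma linked_subset:
  assumes "\<And>b x y. b \<in> F \<Longrightarrow> x \<in> b \<Longrightarrow> y \<in> b \<Longrightarrow> (x, y) \<in> linked G"
  shows "linked F \<subseteq> linked G"
proof -
  have "(\<Union>b\<in>F. b \<times> b) \<subseteq> (\<Union>b\<in>G. b \<times> b)\<^sup>*" using assms unfolding linked_def by blast
  then show ?thesis unfolding linked_def by (rule rtrancl_subset_rtrancl)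
qed

lemma linked_mono: "F \<subseteq> G \<Longrightarrow> linked F \<subseteq> linked G"
  by (rule linked_subset) (blast intro: linked_block)

lemma linked_induct [consumes 1, case_names refl step]:
  assumes "(x, y) \<in> linked F" "P x"
    and "\<And>b y z. (x, y) \<in> linked F \<Longrightarrow> P y \<Longrightarrow> b \<in> F \<Longrightarrow> y \<in> b \<Longrightarrow> z \<in> b \<Longrightarrow> P z"
  shows "P y"
  using assms(1) unfolding linked_def
proof (induction rule: rtrancl_induct)
  case base show ?case by fact
next
  case (step y z)
  then obtain b where "b \<in> F" "y \<in> b" "z \<in> b" by blast
  moreover have "(x, y) \<in> linked F" using step.hyps by (simp add: linked_def)
  ultimately show ?case using assms(3) step.IH by blast
qed

lemma linked_map:
  assumes "(x, y) \<in> linked F" "\<And>b u v. b \<in> F \<Longrightarrow> u \<in> b \<Longrightarrow> v \<in> b \<Longrightarrow> (f u, f v) \<in> linked G"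
  shows "(f x, f y) \<in> linked G"
  using assms(1)
proof (induction rule: linked_induct)
  case (step b y z)
  show ?case by (rule linked_trans[OF step.IH assms(2)[OF step.hyps(2-4)]])
qed simp

lemma linked_in: "(x, y) \<in> linked F \<Longrightarrow> x \<in> V \<Longrightarrow> \<Union>F \<subseteq> V \<Longrightarrow> y \<in> V"
  by (induction rule: linked_induct) auto

section \<open>Components as a partition of the vertices\<close>

lemma conn_comps_eq: "conn_comps V F = comps V F"
  unfolding conn_comps_def comps_def component_def linked_def quotient_def by auto

lemma component_eq_iff:
  assumes "x \<in> V" "y \<in> V"
  shows "component V F x = component V F y \<longleftrightarrow> (x, y) \<in> linked F"
proof
  assume "component V F x = component V F y"
  then have "y \<in> component V F x" using assms by (simp add: component_def)
  then show "(x, y) \<in> linked F" by (simp add: component_def)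
next
  assume "(x, y) \<in> linked F"
  from linked_eq_left[OF this] show "component V F x = component V F y"
    by (simp add: component_def)
qed

lemma component_self: "x \<in> V \<Longrightarrow> x \<in> component V F x"
  by (simp add: component_def)

lemma component_of_mem: "y \<in> component V F x \<Longrightarrow> component V F y = component V F x"
  unfolding component_def using linked_eq_left[of x y F] by auto

lemma comps_memD:
  assumes "c \<in> comps V F" "x \<in> c"
  shows "c = component V F x"
proof -
  obtain z where "c = component V F z" using assms(1) by (auto simp: comps_def)
  with assms(2) component_of_mem[of x V F z] show ?thesis by simp
qed

lemma finite_comps [simp]: "finite V \<Longrightarrow> finite (comps V F)"
  by (simp add: comps_def)

lemma comps_cong: "linked F = linked G \<Longrightarrow> comps V F = comps V G"
  by (simp add: comps_def component_def)

lemma partition_on_comps: "partition_on V (comps V F)"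
proof (rule partition_onI)
  show "\<Union> (comps V F) = V"
    by (auto simp: comps_def component_def)
  show "{} \<notin> comps V F"
    by (auto simp: comps_def component_def)
  show "disjnt p q" if "p \<in> comps V F" "q \<in> comps V F" "p \<noteq> q" for p q
  proof (rule ccontr)
    assume "\<not> disjnt p q"
    then obtain x where "x \<in> p" "x \<in> q" by (auto simp: disjnt_def)
    then show False using that comps_memD[of p V F x] comps_memD[of q V F x] by simp
  qed
qed

text \<open>Sending a \<open>G\<close>-component to the \<open>F\<close>-component of the image of a
  representative is independent of the representative by the last hypothesis and onto by the
  covering hypothesis. All later comparisons of counts on different vertex sets rest on
  this.\<close>

lemma ncomp_le:
  assumes "finite A" "f ` A \<subseteq> V"
    and cover: "\<And>v. v \<in> V \<Longrightarrow> \<exists>a\<in>A. (v, f a) \<in> linked F"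
    and link: "\<And>a b. a \<in> A \<Longrightarrow> b \<in> A \<Longrightarrow> (a, b) \<in> linked G \<Longrightarrow> (f a, f b) \<in> linked F"
  shows "ncomp V F \<le> ncomp A G"
proof -
  define g where "g c = component V F (f (SOME a. a \<in> c))" for c
  have "comps V F \<subseteq> g ` comps A G"
  proof
    fix c assume "c \<in> comps V F"
    then obtain v where v: "v \<in> V" "c = component V F v" by (auto simp: comps_def)
    obtain a where a: "a \<in> A" "(v, f a) \<in> linked F" using cover v by blast
    define a' where "a' = (SOME a'. a' \<in> component A G a)"
    have "a' \<in> component A G a"
      unfolding a'_def using component_self[OF a(1)] by (rule someI)
    then have "a' \<in> A" "(a, a') \<in> linked G"
      by (auto simp: component_def)
    then have "f a' \<in> V" "(v, f a') \<in> linked F"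
      using a link[of a a'] assms(2) linked_trans[of v "f a"] by auto
    then have "c = g (component A G a)"
      using v component_eq_iff[of v V "f a'" F] by (simp add: g_def a'_def)
    then show "c \<in> g ` comps A G" using a by (auto simp: comps_def)
  qed
  then show ?thesis using assms(1) by (meson finite_comps surj_card_le)
qed

lemma ncomp_antimono: "finite V \<Longrightarrow> F \<subseteq> G \<Longrightarrow> ncomp V G \<le> ncomp V F"
proof (rule ncomp_le[where f = id])
  show "\<exists>a\<in>V. (v, id a) \<in> linked G" if "v \<in> V" for v
    using that by (intro bexI[of _ v]) auto
qed (use linked_mono[of F G] in auto)

text \<open>Collapsing vertices that are already linked cannot merge components. One inequality
  comes from \<open>f\<close>, the other from a section of \<open>f\<close>, which is determined up
  to linkage. It serves both for injective relabellings and for gluing rows together.\<close>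

lemma ncomp_contract:
  assumes "finite V" "\<Union>F \<subseteq> V" "\<And>x y. x \<in> V \<Longrightarrow> y \<in> V \<Longrightarrow> f x = f y \<Longrightarrow> (x, y) \<in> linked F"
  shows "ncomp (f ` V) ((`) f ` F) = ncomp V F"
proof (rule antisym)
  show "ncomp (f ` V) ((`) f ` F) \<le> ncomp V F"
  proof (rule ncomp_le[where f = f])
    show "(f a, f b) \<in> linked ((`) f ` F)" if "(a, b) \<in> linked F" for a b
      using that by (rule linked_map) (auto intro: linked_block)
    show "\<exists>a\<in>V. (v, f a) \<in> linked ((`) f ` F)" if "v \<in> f ` V" for v
      using that by (metis imageE linked_refl)
  qed (use assms in auto)
  have inv: "inv_into V f (f x) \<in> V" "f (inv_into V f (f x)) = f x" if "x \<in> V" for x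
    using that by (auto intro: inv_into_into f_inv_into_f)
  show "ncomp V F \<le> ncomp (f ` V) ((`) f ` F)"
  proof (rule ncomp_le[where f = "inv_into V f"])
    show "\<exists>a\<in>f ` V. (v, inv_into V f a) \<in> linked F" if "v \<in> V" for v
      using that inv assms(3) by (intro bexI[of _ "f v"]) auto
    show "(inv_into V f a, inv_into V f b) \<in> linked F" if "(a, b) \<in> linked ((`) f ` F)" for a b
      using that
    proof (rule linked_map)
      fix c u v assume "c \<in> (`) f ` F" "u \<in> c" "v \<in> c"
      then obtain d x y where d: "d \<in> F" "x \<in> d" "y \<in> d" "u = f x" "v = f y" by auto
      then have V: "x \<in> V" "y \<in> V" using assms(2) by auto
      have "(inv_into V f u, x) \<in> linked F" "(y, inv_into V f v) \<in> linked F"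
        using V d inv assms(3) by auto
      then show "(inv_into V f u, inv_into V f v) \<in> linked F"
        using linked_block[OF d(1-3)] by (metis linked_trans)
    qed
  qed (use assms inv in auto)
qed

text \<open>As \<open>G\<close> lives inside \<open>A\<close>, components of \<open>F\<close>
  missing \<open>A\<close> survive untouched, and the others act on \<open>A\<close> only through
  their traces. With \<open>A\<close> the two outer rows of a stack, the first kind are the loops
  and the traces are the blocks of the composition.\<close>

lemma ncomp_eliminate:
  assumes fin: "finite V" and V: "A \<subseteq> V" "\<Union>F \<subseteq> V" "\<Union>G \<subseteq> A"
  shows "ncomp V (F \<union> G) = card {c \<in> comps V F. c \<inter> A = {}}
    + ncomp A (((\<lambda>c. c \<inter> A) ` comps V F - {{}}) \<union> G)"
proof -
  define D where "D = (\<lambda>c. c \<inter> A) ` comps V F - {{}}"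
  let ?C = "comps V (F \<union> G)"
  have D1: "(x, y) \<in> linked D" if "x \<in> A" "y \<in> A" "(x, y) \<in> linked F" for x y
  proof (rule linked_block)
    show "component V F x \<inter> A \<in> D" using that V by (auto simp: D_def comps_def component_def)
  qed (use that V in \<open>auto simp: component_def\<close>)
  have D2: "linked (D \<union> G) \<subseteq> linked (F \<union> G)"
  proof (rule linked_subset)
    fix b x y assume b: "b \<in> D \<union> G" and xy: "x \<in> b" "y \<in> b"
    show "(x, y) \<in> linked (F \<union> G)"
    proof (cases "b \<in> G")
      case True then show ?thesis using xy by (auto intro: linked_block)
    next
      case False
      then obtain v where "(v, x) \<in> linked F" "(v, y) \<in> linked F"
        using b xy unfolding D_def comps_def component_def by blast
      then have "(x, y) \<in> linked F" using linked_eq_left[of v x F y] by simp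
      then show ?thesis using linked_mono[of F "F \<union> G"] by auto
    qed
  qed
  \<comment> \<open>A path from \<open>A\<close> is cut at some vertex \<open>a'\<close> of
    \<open>A\<close>: up to there traces and blocks of \<open>G\<close> record it, afterwards it
    uses \<open>F\<close> alone.\<close>
  have D3: "\<exists>a'\<in>A. (a, a') \<in> linked (D \<union> G) \<and> (a', v) \<in> linked F"
    if "(a, v) \<in> linked (F \<union> G)" "a \<in> A" for a v
    using that(1)
  proof (induction rule: linked_induct)
    case refl then show ?case using that by (intro bexI[of _ a]) auto
  next
    case (step b y z)
    then obtain a' where a': "a' \<in> A" "(a, a') \<in> linked (D \<union> G)" "(a', y) \<in> linked F" by blast
    show ?case
    proof (cases "b \<in> F")
      case True
      then have "(a', z) \<in> linked F" using a' step linked_block[of b F y z] linked_trans[of a' y F z] by simp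
      then show ?thesis using a' by blast
    next
      case False
      then have "b \<in> G" "y \<in> A" "z \<in> A" using step V by auto
      then have "(a', y) \<in> linked (D \<union> G)" "(y, z) \<in> linked (D \<union> G)"
        using D1[of a' y] a' linked_mono[of D "D \<union> G"] step linked_block[of b "D \<union> G"] by auto
      then have "(a, z) \<in> linked (D \<union> G)" using a' by (metis linked_trans)
      then show ?thesis using \<open>z \<in> A\<close> by (intro bexI[of _ z]) auto
    qed
  qed
  have D4: "(a, b) \<in> linked (F \<union> G) \<longleftrightarrow> (a, b) \<in> linked (D \<union> G)" if "a \<in> A" "b \<in> A" for a b
  proof
    assume "(a, b) \<in> linked (F \<union> G)"
    then obtain a' where "a'\<in>A" "(a, a') \<in> linked (D \<union> G)" "(a', b) \<in> linked F" using D3 \<open>a \<in> A\<close> by blast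
    then show "(a, b) \<in> linked (D \<union> G)"
      using D1[of a' b] that linked_mono[of D "D \<union> G"] linked_trans[of a a' _ b] by auto
  qed (use D2 in blast)
  have comp_A: "component V (F \<union> G) x \<inter> A = component A (D \<union> G) x" if "x \<in> A" for x
    using D4 that V by (auto simp: component_def)
  have "bij_betw (\<lambda>c. c \<inter> A) {c \<in> ?C. c \<inter> A \<noteq> {}} (comps A (D \<union> G))"
  proof (rule bij_betw_imageI)
    note eq = comps_memD[of _ V "F \<union> G"]
    show "inj_on (\<lambda>c. c \<inter> A) {c \<in> ?C. c \<inter> A \<noteq> {}}"
    proof (rule inj_onI)
      fix c d assume "c \<in> {c \<in> ?C. c \<inter> A \<noteq> {}}" "d \<in> {c \<in> ?C. c \<inter> A \<noteq> {}}" "c \<inter> A = d \<inter> A"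
      then obtain x where "x \<in> c" "x \<in> d" "c \<in> ?C" "d \<in> ?C" by blast
      then show "c = d" using eq[of c x] eq[of d x] by simp
    qed
    show "(\<lambda>c. c \<inter> A) ` {c \<in> ?C. c \<inter> A \<noteq> {}} = comps A (D \<union> G)"
    proof (intro equalityI subsetI)
      fix c assume "c \<in> (\<lambda>c. c \<inter> A) ` {c \<in> ?C. c \<inter> A \<noteq> {}}"
      then obtain d x where d: "d \<in> ?C" "c = d \<inter> A" "x \<in> d" "x \<in> A" by blast
      have "c = component A (D \<union> G) x"
        unfolding d(2) eq[OF d(1,3)] by (rule comp_A[OF d(4)])
      then show "c \<in> comps A (D \<union> G)" using d(4) by (simp add: comps_def)
    next
      fix c assume "c \<in> comps A (D \<union> G)"
      then obtain x where x: "x \<in> A" "c = component V (F \<union> G) x \<inter> A"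
        using comp_A by (auto simp: comps_def)
      then have "component V (F \<union> G) x \<in> ?C" "x \<in> component V (F \<union> G) x \<inter> A"
        using V component_self[of x V "F \<union> G"] by (auto simp: comps_def)
      then show "c \<in> (\<lambda>c. c \<inter> A) ` {c \<in> ?C. c \<inter> A \<noteq> {}}"
        using x(2) by blast
    qed
  qed
  then have 1: "card {c \<in> ?C. c \<inter> A \<noteq> {}} = ncomp A (D \<union> G)" by (rule bij_betw_same_card)
  \<comment> \<open>Blocks of \<open>G\<close> lie in \<open>A\<close>, so a path starting in an
    \<open>F\<close>-component that avoids \<open>A\<close> can never enter one.\<close>
  have away: "(x, y) \<in> linked F \<and> y \<notin> A"
    if "(x, y) \<in> linked (F \<union> G)" "\<And>z. (x, z) \<in> linked F \<Longrightarrow> z \<notin> A" for x y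
    using that(1)
  proof (induction rule: linked_induct)
    case refl then show ?case using that(2) by auto
  next
    case (step b y z)
    then have "b \<in> F" using V by auto
    then have "(x, z) \<in> linked F" using step linked_block[of b F y z] linked_trans[of x y F z] by simp
    then show ?case using that(2) by blast
  qed
  have mono: "linked F \<subseteq> linked (F \<union> G)" by (rule linked_mono) simp
  have comp_F: "component V (F \<union> G) x = component V F x"
    if "x \<in> V" "component V F x \<inter> A = {}" for x
  proof -
    have "z \<notin> A" if "(x, z) \<in> linked F" for z
      using that \<open>component V F x \<inter> A = {}\<close> V linked_in[OF that \<open>x \<in> V\<close>] by (auto simp: component_def)
    then show ?thesis using away[of x] mono by (auto simp: component_def)
  qed
  have sub: "component V F x \<subseteq> component V (F \<union> G) x" for x
    using mono by (auto simp: component_def)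
  have 2: "{c \<in> ?C. c \<inter> A = {}} = {c \<in> comps V F. c \<inter> A = {}}"
  proof (intro equalityI subsetI)
    fix c assume "c \<in> {c \<in> ?C. c \<inter> A = {}}"
    then obtain x where x: "x \<in> V" "c = component V (F \<union> G) x" "c \<inter> A = {}"
      by (auto simp: comps_def)
    then have "component V F x \<inter> A = {}" using sub[of x] by blast
    then have "c = component V F x" using comp_F[of x] x by simp
    then show "c \<in> {c \<in> comps V F. c \<inter> A = {}}" using x by (simp add: comps_def)
  next
    fix c assume "c \<in> {c \<in> comps V F. c \<inter> A = {}}"
    then obtain x where x: "x \<in> V" "c = component V F x" "c \<inter> A = {}"
      by (auto simp: comps_def)
    then have "c = component V (F \<union> G) x" using comp_F[of x] by simp
    then show "c \<in> {c \<in> ?C. c \<inter> A = {}}" using x by (simp add: comps_def)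
  qed
  have split: "{c \<in> ?C. c \<inter> A = {}} \<union> {c \<in> ?C. c \<inter> A \<noteq> {}} = ?C"
    "{c \<in> ?C. c \<inter> A = {}} \<inter> {c \<in> ?C. c \<inter> A \<noteq> {}} = {}" by auto
  have "finite {c \<in> ?C. c \<inter> A = {}}" "finite {c \<in> ?C. c \<inter> A \<noteq> {}}" using fin by simp_all
  from card_Un_disjoint[OF this split(2)]
  have "card ?C = card {c \<in> ?C. c \<inter> A = {}} + card {c \<in> ?C. c \<inter> A \<noteq> {}}"
    unfolding split(1) .
  then show ?thesis unfolding 1 2 D_def .
qed

section \<open>Effect of one additional edge\<close>

lemma linked_insert_edge:
  "(u, v) \<in> linked (insert {x, y} F) \<longleftrightarrow>
    (u, v) \<in> linked F \<or> (u, x) \<in> linked F \<and> (y, v) \<in> linked F \<or> (u, y) \<in> linked F \<and> (x, v) \<in> linked F"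
    (is "?L \<longleftrightarrow> ?R v")
proof
  assume ?L
  then show "?R v"
  proof (induction rule: linked_induct)
    case (step b w z)
    have cases: "(w, z) \<in> linked F \<or> w = x \<and> z = y \<or> w = y \<and> z = x \<or> w = z"
      using step linked_block[of b F w z] by blast
    show ?case
    proof -
      consider "(w, z) \<in> linked F" | "w = x" "z = y" | "w = y" "z = x" | "w = z" using cases by blast
      then show ?thesis
      proof cases
        case 1 then show ?thesis using step.IH linked_eq_right[OF 1] by simp
      next
        case 2
        have "(u, x) \<in> linked F \<or> (u, y) \<in> linked F"
          using step.IH 2 by auto
        then show ?thesis using 2 by auto
      next
        case 3
        have "(u, x) \<in> linked F \<or> (u, y) \<in> linked F"
          using step.IH 3 by auto
        then show ?thesis using 3 by auto
      qed (use step.IH in simp)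
    qed
  qed simp
next
  have F: "(a, b) \<in> linked (insert {x, y} F)" if "(a, b) \<in> linked F" for a b
    using that linked_mono[of F "insert {x, y} F"] by auto
  have xy: "(x, y) \<in> linked (insert {x, y} F)" "(y, x) \<in> linked (insert {x, y} F)"
    by (auto intro: linked_block[of "{x, y}"])
  show "?R v \<Longrightarrow> ?L" using F xy by (metis linked_trans)
qed

lemma linked_insert_linked:
  assumes "(x, y) \<in> linked F"
  shows "linked (insert {x, y} F) = linked F"
proof -
  have "(u, v) \<in> linked (insert {x, y} F) \<longleftrightarrow> (u, v) \<in> linked F" for u v
    unfolding linked_insert_edge by (metis assms linked_eq_left linked_eq_right)
  then show ?thesis by auto
qed

text \<open>The two distinct components of the endpoints are replaced by their union, which was not
  a component before, and no other component changes.\<close>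

lemma ncomp_insert_edge:
  assumes "finite V" "x \<in> V" "y \<in> V" "(x, y) \<notin> linked F"
  shows "ncomp V F = Suc (ncomp V (insert {x, y} F))"
proof -
  let ?X = "component V F x" and ?Y = "component V F y" and ?C = "comps V F"
  have XY: "?X \<in> ?C" "?Y \<in> ?C" "?X \<noteq> ?Y"
    using assms component_eq_iff[of x V y F] by (auto simp: comps_def)
  have nu: "?X \<union> ?Y \<notin> ?C"
  proof
    assume "?X \<union> ?Y \<in> ?C"
    then obtain z where "?X \<union> ?Y = component V F z" by (auto simp: comps_def)
    then have "x \<in> component V F z" "y \<in> component V F z"
      using component_self[of x V F] component_self[of y V F] assms by auto
    then show False using XY component_of_mem[of x V F z] component_of_mem[of y V F z] by simp
  qed
  have new: "component V (insert {x, y} F) z =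
      (if z \<in> ?X \<union> ?Y then ?X \<union> ?Y else component V F z)" if "z \<in> V" for z
  proof -
    have "(z, w) \<in> linked (insert {x, y} F) \<longleftrightarrow>
        (if (x, z) \<in> linked F \<or> (y, z) \<in> linked F then (x, w) \<in> linked F \<or> (y, w) \<in> linked F
         else (z, w) \<in> linked F)" for w
      unfolding linked_insert_edge by (metis linked_eq_left linked_eq_right linked_sym)
    then show ?thesis using that by (auto simp: component_def)
  qed
  have "comps V (insert {x, y} F) = insert (?X \<union> ?Y) (?C - {?X, ?Y})"
  proof (intro equalityI subsetI)
    fix c assume "c \<in> comps V (insert {x, y} F)"
    then obtain z where z: "z \<in> V" "c = component V (insert {x, y} F) z" by (auto simp: comps_def)
    show "c \<in> insert (?X \<union> ?Y) (?C - {?X, ?Y})"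
    proof (cases "z \<in> ?X \<union> ?Y")
      case False
      then have "component V F z \<noteq> ?X" "component V F z \<noteq> ?Y"
        using component_self[of z V F] z by auto
      then show ?thesis using z new[of z] False by (auto simp: comps_def)
    qed (use z new in auto)
  next
    fix c assume c: "c \<in> insert (?X \<union> ?Y) (?C - {?X, ?Y})"
    show "c \<in> comps V (insert {x, y} F)"
    proof (cases "c = ?X \<union> ?Y")
      case True
      then have "c = component V (insert {x, y} F) x" using new[of x] component_self[of x V F] assms by simp
      then show ?thesis using assms by (simp add: comps_def)
    next
      case False
      then obtain z where z: "z \<in> V" "c = component V F z" "c \<noteq> ?X" "c \<noteq> ?Y"
        using c by (auto simp: comps_def)
      then have "z \<notin> ?X \<union> ?Y"
        using component_of_mem[of z V F x] component_of_mem[of z V F y] by auto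
      then have "c = component V (insert {x, y} F) z" using new z by simp
      then show ?thesis using z by (simp add: comps_def)
    qed
  qed
  then have "ncomp V (insert {x, y} F) = Suc (card (?C - {?X, ?Y}))"
    using nu assms by simp
  moreover have "card (?C - {?X, ?Y}) = card ?C - 2"
    using XY by (subst card_Diff_subset) auto
  \<comment> \<open>\<open>?C\<close> has at least two elements, so the natural subtraction above
    does not truncate.\<close>
  moreover have "card {?X, ?Y} \<le> card ?C" using XY assms by (intro card_mono) auto
  ultimately show ?thesis using XY by simp
qed

text \<open>Adding edges merges fewer components the more is already linked; this is the semimodularity
  of the partition lattice.\<close>

lemma ncomp_submodular:
  assumes "finite G" "finite V" "W \<subseteq> V" "F \<subseteq> F'" "\<And>e. e \<in> G \<Longrightarrow> \<exists>x\<in>W. \<exists>y\<in>W. e = {x, y}"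
  shows "ncomp V F' + ncomp W (F \<union> G) \<le> ncomp W F + ncomp V (F' \<union> G)"
  using assms(1,5)
proof (induction G rule: finite_induct)
  case (insert e G)
  obtain x y where e: "x \<in> W" "y \<in> W" "e = {x, y}" using insert.prems by blast
  have IH: "ncomp V F' + ncomp W (F \<union> G) \<le> ncomp W F + ncomp V (F' \<union> G)"
    using insert by auto
  have W: "finite W" using assms finite_subset by blast
  show ?case
  \<comment> \<open>An edge that is redundant over the smaller family is redundant over the larger
    one. Hence the right-hand side loses one only in the case where the left-hand side loses exactly
    one.\<close>
  proof (cases "(x, y) \<in> linked (F \<union> G)")
    case True
    then have "(x, y) \<in> linked (F' \<union> G)" using linked_mono[of "F \<union> G" "F' \<union> G"] assms(4) by auto
    then have "comps W (F \<union> insert e G) = comps W (F \<union> G)"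
      "comps V (F' \<union> insert e G) = comps V (F' \<union> G)"
      using True e by (auto intro!: comps_cong linked_insert_linked)
    then show ?thesis using IH by simp
  next
    case False
    then have "ncomp W (F \<union> G) = Suc (ncomp W (F \<union> insert e G))"
      using ncomp_insert_edge[OF W e(1,2)] e(3) by simp
    moreover have "ncomp V (F' \<union> G) \<le> Suc (ncomp V (F' \<union> insert e G))"
    proof (cases "(x, y) \<in> linked (F' \<union> G)")
      case True
      then have "comps V (F' \<union> insert e G) = comps V (F' \<union> G)"
        using e by (auto intro!: comps_cong linked_insert_linked)
      then show ?thesis by simp
    next
      case False
      then show ?thesis using ncomp_insert_edge[OF assms(2), of x y "F' \<union> G"] e assms(3)
        by (simp add: subset_eq)
    qed
    ultimately show ?thesis using IH by simp
  qed
qed simp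

lemma comps_partition:
  assumes "partition_on V p"
  shows "comps V p = p"
proof -
  have link: "(x, y) \<in> linked p \<longleftrightarrow> y \<in> b" if "b \<in> p" "x \<in> b" for b x y
  proof
    assume "(x, y) \<in> linked p"
    then show "y \<in> b"
    proof (induction rule: linked_induct)
      case (step c y z)
      then have "c = b" using that assms partition_onD2[of V p] by (auto dest: disjointD)
      then show ?case using step by simp
    qed (rule that)
  qed (use that in \<open>auto intro: linked_block\<close>)
  have comp: "component V p x = b" if "b \<in> p" "x \<in> b" for b x
    using link[OF that] that assms partition_onD1[of V p] by (auto simp: component_def)
  show ?thesis
  proof (intro equalityI subsetI)
    fix c assume "c \<in> comps V p"
    then obtain x where "x \<in> V" "c = component V p x" by (auto simp: comps_def)
    then show "c \<in> p" using assms comp partition_onD1[of V p] by (metis UnionE)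
  next
    fix b assume "b \<in> p"
    then obtain x where "x \<in> b" using assms partition_onD3[of V p] by (metis ex_in_conv)
    then have "x \<in> V" "b = component V p x" using \<open>b \<in> p\<close> assms comp partition_onD1[of V p] by auto
    then show "b \<in> comps V p" by (auto simp: comps_def)
  qed
qed

section \<open>Counting blocks of diagrams\<close>

lemma finite_verts [simp]: "finite (verts k)" by (simp add: verts_def)

lemma Union_Parts: "p \<in> Parts k \<Longrightarrow> \<Union>p = verts k"
  unfolding Parts_def using partition_onD1 by blast

lemma finite_Parts [simp]: "finite (Parts k)"
  unfolding Parts_def by (simp add: finitely_many_partition_on)

lemma nc_eq_ncomp: "p \<in> Parts k \<Longrightarrow> nc p = ncomp (verts k) p"
  by (simp add: nc_def Parts_def comps_partition)

lemma refines_comps: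
  assumes "partition_on V p" "p \<subseteq> F"
  shows "refines V p (comps V F)"
  unfolding refines_def
proof (intro conjI ballI)
  fix b assume "b \<in> p"
  then obtain x where x: "x \<in> b" using assms(1) partition_onD3[of V p] by (metis ex_in_conv)
  have "b \<subseteq> V" using \<open>b \<in> p\<close> assms(1) partition_onD1[of V p] by auto
  then have "b \<subseteq> component V F x"
    using \<open>b \<in> p\<close> x assms(2) linked_block[of b F x] by (auto simp: component_def)
  moreover have "component V F x \<in> comps V F" using x \<open>b \<subseteq> V\<close> by (auto simp: comps_def)
  ultimately show "\<exists>c\<in>comps V F. b \<subseteq> c" by (rule bexI)
qed (use assms partition_on_comps in auto)

lemma comps_refines:
  assumes "partition_on V r" "\<And>b. b \<in> F \<Longrightarrow> \<exists>c\<in>r. b \<subseteq> c"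
  shows "refines V (comps V F) r"
  unfolding refines_def
proof (intro conjI ballI)
  have "linked F \<subseteq> linked r"
  proof (rule linked_subset)
    fix b x y assume "b \<in> F" and xy: "x \<in> b" "y \<in> b"
    then obtain c where "c \<in> r" "b \<subseteq> c" using assms(2) by blast
    then show "(x, y) \<in> linked r" using xy linked_block[of c r x y] by auto
  qed
  then have sub: "component V F x \<subseteq> component V r x" for x
    by (auto simp: component_def)
  fix b assume "b \<in> comps V F"
  then obtain x where x: "x \<in> V" "b = component V F x" by (auto simp: comps_def)
  then have "component V r x \<in> comps V r" by (simp add: comps_def)
  then have "component V r x \<in> r" by (simp only: comps_partition[OF assms(1)])
  then show "\<exists>c\<in>r. b \<subseteq> c" using sub[of x] x(2) by (intro bexI[of _ "component V r x"]) simp_all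
qed (use assms partition_on_comps in auto)

text \<open>The components of the union lie below every common coarsening, and antisymmetry of
  refinement makes the description unique. From here on joins are component counts.\<close>

lemma join_part_eq:
  assumes "p \<in> Parts k" "p' \<in> Parts k"
  shows "join_part k p p' = comps (verts k) (p \<union> p')"
proof -
  let ?V = "verts k" and ?q = "comps (verts k) (p \<union> p')"
  have up: "refines ?V p ?q" "refines ?V p' ?q"
    using assms by (auto simp: Parts_def intro: refines_comps)
  have least: "refines ?V ?q r" if "refines ?V p r" "refines ?V p' r" for r
    using that by (intro comps_refines) (auto simp: refines_def)
  show ?thesis
    unfolding join_part_def
  proof (rule the_equality)
    fix q assume "refines ?V p q \<and> refines ?V p' q \<and>
        (\<forall>r. refines ?V p r \<and> refines ?V p' r \<longrightarrow> refines ?V q r)"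
    then have "refines ?V q ?q" "refines ?V ?q q" using up least[of q] by simp_all
    then show "q = ?q" by (rule refines_asym)
  qed (use up least in simp)
qed

lemma nc_join: "p \<in> Parts k \<Longrightarrow> p' \<in> Parts k \<Longrightarrow> nc (join_part k p p') = ncomp (verts k) (p \<union> p')"
  by (simp add: nc_def join_part_eq)

lemma ncomp_less:
  assumes "finite V" "F \<subseteq> G" "x \<in> V" "y \<in> V" "(x, y) \<in> linked G" "(x, y) \<notin> linked F"
  shows "ncomp V G < ncomp V F"
proof -
  have "comps V G = comps V (insert {x, y} G)"
    by (rule comps_cong) (simp add: linked_insert_linked assms(5))
  moreover have "ncomp V (insert {x, y} G) \<le> ncomp V (insert {x, y} F)"
    using assms by (intro ncomp_antimono) auto
  ultimately show ?thesis using ncomp_insert_edge[of V x y F] assms by simp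
qed

text \<open>Joining never creates blocks, and if neither partition lost a link relative to the
  union, both would equal its components. This is the strict positivity of \<open>part_dist\<close>,
  from which unitriangularity follows.\<close>

lemma nc_join_less:
  assumes "p \<in> Parts k" "q \<in> Parts k" "p \<noteq> q"
  shows "2 * nc (join_part k q p) < nc q + nc p"
proof -
  let ?V = "verts k"
  have le: "ncomp ?V (q \<union> p) \<le> ncomp ?V q" "ncomp ?V (q \<union> p) \<le> ncomp ?V p"
    by (auto intro: ncomp_antimono)
  have "\<exists>r\<in>{p, q}. \<exists>x\<in>?V. \<exists>y\<in>?V. (x, y) \<in> linked (q \<union> p) \<and> (x, y) \<notin> linked r"
  proof (rule ccontr)
    assume H: "\<not> ?thesis"
    have "component ?V r x = component ?V (q \<union> p) x" if "r \<in> {p, q}" "x \<in> ?V" for r x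
      using H that linked_mono[of r "q \<union> p"] unfolding component_def by blast
    then have "comps ?V r = comps ?V (q \<union> p)" if "r \<in> {p, q}" for r
      using that unfolding comps_def by simp
    then have "comps ?V p = comps ?V q" by simp
    then show False using assms by (simp add: Parts_def comps_partition)
  qed
  then obtain r x y where "r \<in> {p, q}" "x \<in> ?V" "y \<in> ?V" "(x, y) \<in> linked (q \<union> p)" "(x, y) \<notin> linked r"
    by blast
  then have "ncomp ?V (q \<union> p) < ncomp ?V r" by (intro ncomp_less[of _ _ _ x y]) auto
  then show ?thesis using le \<open>r \<in> {p, q}\<close> assms by (auto simp: nc_join nc_eq_ncomp)
qed

lemma id_part_in_Parts [simp]: "id_part k \<in> Parts k"
  by (auto simp: Parts_def id_part_def verts_def disjnt_def intro!: partition_onI)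

lemma id_part_edge:
  assumes "e \<in> id_part k" shows "\<exists>x\<in>verts k. \<exists>y\<in>verts k. e = {x, y}"
  using assms unfolding id_part_def verts_def by blast

text \<open>The triangle inequality for \<open>part_dist\<close> through \<open>q\<close>, with the
  halves cancelled. Adding the identity edges to \<open>q\<close> merges at least as many blocks as
  adding them to the join of \<open>q\<close> and \<open>p\<close>, and dropping \<open>q\<close>
  afterwards can only increase the count.\<close>

lemma nc_triangle:
  assumes "p \<in> Parts k" "q \<in> Parts k"
  shows "nc (join_part k q (id_part k)) + nc (join_part k q p) \<le> nc q + nc (join_part k p (id_part k))"
proof -
  let ?V = "verts k" and ?o = "id_part k"
  have "ncomp ?V (q \<union> p) + ncomp ?V (q \<union> ?o) \<le> ncomp ?V q + ncomp ?V (q \<union> p \<union> ?o)"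
    by (intro ncomp_submodular id_part_edge) (auto simp: id_part_def)
  moreover have "ncomp ?V (q \<union> p \<union> ?o) \<le> ncomp ?V (p \<union> ?o)"
    by (intro ncomp_antimono) auto
  ultimately show ?thesis using assms by (simp add: nc_join nc_eq_ncomp)
qed

section \<open>Moving diagrams between levels and stacking them\<close>

lemma relabel_relabel: "relabel f (relabel g p) = relabel (f \<circ> g) p"
  by (simp add: relabel_def image_image prod.map_comp comp_def id_def)

lemma relabel_Un: "relabel f (p \<union> q) = relabel f p \<union> relabel f q"
  by (auto simp: relabel_def)

text \<open>Vertices of a diagram never lie on \<open>Mid\<close>, so the value of a level map there
  is free. Composite level maps can thus be simplified by checking two levels.\<close>

lemma relabel_cong:
  assumes "p \<in> Parts k" "f Top = g Top" "f Bot = g Bot"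
  shows "relabel f p = relabel g p"
proof -
  have "map_prod f id x = map_prod g id x" if "x \<in> b" "b \<in> p" for b x
  proof -
    have "x \<in> verts k" using that assms(1) Union_Parts by blast
    then show ?thesis using assms(2,3) by (auto simp: verts_def)
  qed
  then show ?thesis unfolding relabel_def by (intro image_cong) auto
qed

lemma relabel_id: "relabel id p = p"
  by (simp add: relabel_def prod.map_id0)

lemma relabel_ident:
  "p \<in> Parts k \<Longrightarrow> f Top = Top \<Longrightarrow> f Bot = Bot \<Longrightarrow> relabel f p = p"
  using relabel_cong[of p k f id] by (simp add: relabel_id)

lemma Union_relabel: "\<Union>(relabel f p) = map_prod f id ` \<Union>p"
  by (auto simp: relabel_def)

lemma ncomp_relabel:
  assumes "finite V" "\<Union>F \<subseteq> V" "inj_on (map_prod f id) V"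
  shows "ncomp (map_prod f id ` V) (relabel f F) = ncomp V F"
  unfolding relabel_def
  by (rule ncomp_contract[OF assms(1,2)]) (metis assms(3) inj_onD linked_refl)

abbreviation lift_up :: "level \<Rightarrow> level" where
  "lift_up l \<equiv> if l = Bot then Mid else l"

abbreviation lift_down :: "level \<Rightarrow> level" where
  "lift_down l \<equiv> if l = Top then Mid else l"

definition levels :: "nat \<Rightarrow> vertex set" where
  "levels k = {Top, Mid, Bot} \<times> {1..k}"

lemma finite_levels [simp]: "finite (levels k)" by (simp add: levels_def)

lemma verts_subset_levels: "verts k \<subseteq> levels k" by (auto simp: levels_def verts_def)

lemma join_part_commute: "p \<in> Parts k \<Longrightarrow> q \<in> Parts k \<Longrightarrow> join_part k p q = join_part k q p"
  by (simp add: join_part_eq Un_commute)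

lemma transp_in_Parts [simp]:
  assumes "p \<in> Parts k" shows "transp p \<in> Parts k"
proof -
  let ?t = "\<lambda>l. case l of Top \<Rightarrow> Bot | Bot \<Rightarrow> Top | Mid \<Rightarrow> Mid"
  have "inj_on (map_prod ?t id) (verts k)"
    by (auto simp: inj_on_def verts_def)
  moreover have "map_prod ?t id ` verts k = verts k"
    unfolding verts_def by (intro map_prod_surj_on) auto
  moreover have "{} \<notin> relabel ?t p"
    using assms partition_onD3 by (auto simp: relabel_def Parts_def)
  ultimately show ?thesis
    using partition_on_inj_image[of "verts k" p "map_prod ?t id"] assms
    by (auto simp: transp_def Parts_def relabel_def)
qed

lemma stack_eq:
  "stack k p p' = comps (levels k) (relabel lift_up p' \<union> relabel lift_down p)"
  by (simp add: stack_def conn_comps_eq levels_def)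

lemma compose_in_Parts [simp]: "compose k p p' \<in> Parts k"
proof -
  have "partition_on (verts k \<inter> levels k) ((\<inter>) (verts k) ` stack k p p' - {{}})"
    unfolding stack_eq by (intro partition_on_restrict partition_on_comps)
  moreover have "verts k \<inter> levels k = verts k" using verts_subset_levels by auto
  ultimately show ?thesis by (simp add: Parts_def compose_def Int_commute)
qed

lemma Union_stack_blocks:
  assumes "p \<in> Parts k" "p' \<in> Parts k"
  shows "\<Union>(relabel lift_up p' \<union> relabel lift_down p) \<subseteq> levels k"
  using Union_Parts[OF assms(1)] Union_Parts[OF assms(2)]
  by (auto simp: Union_relabel verts_def levels_def simp del: Union_iff)

text \<open>An instance of \<open>ncomp_eliminate\<close> with the middle row removed. The extra
  family \<open>G\<close> carries whatever is joined to the composition afterwards.\<close>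

lemma ncomp_stack:
  assumes "p \<in> Parts k" "p' \<in> Parts k" "\<Union>G \<subseteq> verts k"
  shows "ncomp (levels k) (relabel lift_up p' \<union> relabel lift_down p \<union> G)
    = nloops k p p' + ncomp (verts k) (compose k p p' \<union> G)"
proof -
  have "c \<subseteq> levels k" if "c \<in> stack k p p'" for c
    using that by (auto simp: stack_eq comps_def component_def)
  then have "{c \<in> stack k p p'. c \<inter> verts k = {}} = {c \<in> stack k p p'. c \<subseteq> {Mid} \<times> {1..k}}"
    by (force simp: verts_def levels_def)
  then show ?thesis
    using ncomp_eliminate[of "levels k" "verts k" "relabel lift_up p' \<union> relabel lift_down p" G]
      Union_stack_blocks[OF assms(1,2)] assms(3)
    by (simp add: nloops_def compose_def stack_eq verts_subset_levels)
qed

lemma nc_compose: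
  assumes "p \<in> Parts k" "p' \<in> Parts k"
  shows "ncomp (levels k) (relabel lift_up p' \<union> relabel lift_down p) = nloops k p p' + nc (compose k p p')"
  using ncomp_stack[OF assms, of "{}"] by (simp add: nc_eq_ncomp[OF compose_in_Parts])

lemma nc_compose_join:
  assumes "p \<in> Parts k" "p' \<in> Parts k" "q \<in> Parts k"
  shows "ncomp (levels k) (relabel lift_up p' \<union> relabel lift_down p \<union> q)
    = nloops k p p' + nc (join_part k (compose k p p') q)"
  using ncomp_stack[OF assms(1,2), of q] assms by (simp add: nc_join Union_Parts)

section \<open>Rotating and closing stacks\<close>

lemma ncomp_levels_relabel:
  assumes "bij s" "\<Union>F \<subseteq> levels k" "s ` {Top, Mid, Bot} = {Top, Mid, Bot}"
  shows "ncomp (levels k) F = ncomp (levels k) (relabel s F)"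
proof -
  have "map_prod s id ` levels k = levels k"
    unfolding levels_def using assms(3) by (intro map_prod_surj_on) auto
  moreover have "inj_on (map_prod s id) (levels k)"
    using assms(1) by (intro inj_on_subset[OF prod.inj_map]) (auto simp: bij_def)
  ultimately show ?thesis using ncomp_relabel[of "levels k" F s] assms(2) by simp
qed

text \<open>Both sides count the components of one graph in which \<open>p2\<close>,
  \<open>p1\<close> and \<open>p\<close> connect the three rows pairwise. Exchanging the middle and
  bottom rows makes \<open>p2\<close> the outer diagram and puts \<open>p\<close> above the
  transpose of \<open>p1\<close>.\<close>

lemma nc_rotate_left:
  assumes "p1 \<in> Parts k" "p2 \<in> Parts k" "p \<in> Parts k"
  shows "nloops k p1 p2 + nc (join_part k (compose k p1 p2) p)
    = nloops k (transp p1) p + nc (join_part k p2 (compose k (transp p1) p))"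
proof -
  let ?s = "\<lambda>l. case l of Top \<Rightarrow> Top | Mid \<Rightarrow> Bot | Bot \<Rightarrow> Mid"
  let ?F = "relabel lift_up p2 \<union> relabel lift_down p1 \<union> p"
  have inv: "?s (?s l) = l" for l by (cases l) auto
  have "bij ?s" by (rule o_bij[of ?s]) (use inv in auto)
  moreover have "\<Union>?F \<subseteq> levels k"
    using Union_stack_blocks[OF assms(1,2)] Union_Parts[OF assms(3)] verts_subset_levels by auto
  ultimately have "ncomp (levels k) ?F = ncomp (levels k) (relabel ?s ?F)"
    by (rule ncomp_levels_relabel) auto
  moreover have "relabel ?s (relabel lift_up p2) = p2"
    unfolding relabel_relabel by (rule relabel_ident[OF assms(2)]) auto
  moreover have "relabel ?s (relabel lift_down p1) = relabel lift_down (transp p1)"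
    unfolding relabel_relabel transp_def by (rule relabel_cong[OF assms(1)]) auto
  moreover have "relabel ?s p = relabel lift_up p"
    by (rule relabel_cong[OF assms(3)]) auto
  ultimately have "ncomp (levels k) ?F = ncomp (levels k) (relabel lift_up p \<union> relabel lift_down (transp p1) \<union> p2)"
    by (simp only: relabel_Un Un_ac)
  then show ?thesis
    using nc_compose_join[OF assms] nc_compose_join[of "transp p1" k p p2]
      join_part_commute[of p2 k] assms by simp
qed

text \<open>The same closed diagram, now with the top and middle rows exchanged, so that
  \<open>p1\<close> becomes the outer diagram and \<open>p2\<close> is the one turned over.\<close>

lemma nc_rotate_right:
  assumes "p1 \<in> Parts k" "p2 \<in> Parts k" "p \<in> Parts k"
  shows "nloops k p1 p2 + nc (join_part k (compose k p1 p2) p)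
    = nloops k p (transp p2) + nc (join_part k p1 (compose k p (transp p2)))"
proof -
  let ?s = "\<lambda>l. case l of Top \<Rightarrow> Mid | Mid \<Rightarrow> Top | Bot \<Rightarrow> Bot"
  let ?F = "relabel lift_up p2 \<union> relabel lift_down p1 \<union> p"
  have inv: "?s (?s l) = l" for l by (cases l) auto
  have "bij ?s" by (rule o_bij[of ?s]) (use inv in auto)
  moreover have "\<Union>?F \<subseteq> levels k"
    using Union_stack_blocks[OF assms(1,2)] Union_Parts[OF assms(3)] verts_subset_levels by auto
  ultimately have "ncomp (levels k) ?F = ncomp (levels k) (relabel ?s ?F)"
    by (rule ncomp_levels_relabel) auto
  moreover have "relabel ?s (relabel lift_down p1) = p1"
    unfolding relabel_relabel by (rule relabel_ident[OF assms(1)]) auto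
  moreover have "relabel ?s (relabel lift_up p2) = relabel lift_up (transp p2)"
    unfolding relabel_relabel transp_def by (rule relabel_cong[OF assms(2)]) auto
  moreover have "relabel ?s p = relabel lift_down p"
    by (rule relabel_cong[OF assms(3)]) auto
  ultimately have "ncomp (levels k) ?F = ncomp (levels k) (relabel lift_up (transp p2) \<union> relabel lift_down p \<union> p1)"
    by (simp only: relabel_Un Un_ac)
  then show ?thesis
    using nc_compose_join[OF assms] nc_compose_join[of p k "transp p2" p1]
      join_part_commute[of p1 k] assms by simp
qed

text \<open>Joining with the identity glues the top row to the bottom row, which closes the stack of
  \<open>transp p\<close> and \<open>q\<close> up to the union of the graphs of \<open>p\<close> and \<open>q\<close>.\<close>

lemma nc_close:
  assumes "q \<in> Parts k" "p \<in> Parts k"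
  shows "nloops k q (transp p) + nc (join_part k (compose k q (transp p)) (id_part k))
    = nc (join_part k q p)"
proof -
  \<comment> \<open>The outer rows of the stack go to one row, which is the gluing by the identity,
    and the rows are named so that the two pieces land on \<open>p\<close> and \<open>q\<close>
    themselves.\<close>
  let ?g = "\<lambda>l. case l of Top \<Rightarrow> Bot | Mid \<Rightarrow> Top | Bot \<Rightarrow> Bot"
  let ?F = "relabel lift_up (transp p) \<union> relabel lift_down q \<union> id_part k"
  have sub: "\<Union>?F \<subseteq> levels k"
    using Union_stack_blocks[of q k "transp p"] assms Union_Parts[of "id_part k" k] verts_subset_levels
    by auto
  have id: "((Top, i), (Bot, i)) \<in> linked ?F" if "i \<in> {1..k}" for i
    using that by (intro linked_block[of "{(Top, i), (Bot, i)}"]) (auto simp: id_part_def)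
  have "ncomp (map_prod ?g id ` levels k) ((`) (map_prod ?g id) ` ?F) = ncomp (levels k) ?F"
  proof (rule ncomp_contract[OF _ sub])
    fix x y assume "x \<in> levels k" "y \<in> levels k" "map_prod ?g id x = map_prod ?g id y"
    then consider "x = y" | i where "i \<in> {1..k}" "x = (Top, i)" "y = (Bot, i)"
      | i where "i \<in> {1..k}" "y = (Top, i)" "x = (Bot, i)"
      by (auto simp: levels_def)
    then show "(x, y) \<in> linked ?F" by cases (use id linked_sym[OF id] in auto)
  qed simp
  moreover have "map_prod ?g id ` levels k = verts k"
    unfolding levels_def verts_def by (intro map_prod_surj_on) auto
  moreover have "(`) (map_prod ?g id) ` ?F = p \<union> q \<union> relabel ?g (id_part k)"
  proof -
    have "relabel ?g (relabel lift_up (transp p)) = p"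
      unfolding relabel_relabel transp_def by (rule relabel_ident[OF assms(2)]) auto
    moreover have "relabel ?g (relabel lift_down q) = q"
      unfolding relabel_relabel by (rule relabel_ident[OF assms(1)]) auto
    ultimately have "relabel ?g ?F = p \<union> q \<union> relabel ?g (id_part k)" by (simp add: relabel_Un)
    then show ?thesis by (simp add: relabel_def)
  qed
  \<comment> \<open>The identity edges have been contracted to single points and link
    nothing.\<close>
  moreover have "linked (p \<union> q \<union> relabel ?g (id_part k)) = linked (q \<union> p)"
  proof
    show "linked (p \<union> q \<union> relabel ?g (id_part k)) \<subseteq> linked (q \<union> p)"
    proof (rule linked_subset)
      fix b x y assume "b \<in> p \<union> q \<union> relabel ?g (id_part k)" "x \<in> b" "y \<in> b"
      then show "(x, y) \<in> linked (q \<union> p)"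
        using linked_block[of b "q \<union> p" x y] by (auto simp: relabel_def id_part_def)
    qed
  qed (rule linked_mono, auto)
  ultimately have "ncomp (levels k) ?F = ncomp (verts k) (q \<union> p)"
    using comps_cong[of "p \<union> q \<union> relabel ?g (id_part k)" "q \<union> p" "verts k"] by simp
  then show ?thesis using assms by (simp add: nc_compose_join nc_join)
qed

text \<open>Identity edges are added to the stack twice, between the rows of \<open>p2\<close> and
  between the rows of \<open>p1\<close>. Each time submodularity compares the stack with the smaller
  graph on two rows, where the count is a join with the identity.\<close>

lemma nc_compose_le:
  assumes "p1 \<in> Parts k" "p2 \<in> Parts k"
  shows "nloops k p1 p2 + nc (compose k p1 p2) + nc (join_part k p1 (id_part k)) + nc (join_part k p2 (id_part k))
    \<le> nc p1 + nc p2 + nc (join_part k (compose k p1 p2) (id_part k))"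
proof -
  let ?o = "id_part k" and ?u = "map_prod lift_up id" and ?d = "map_prod lift_down id"
  let ?P2 = "relabel lift_up p2" and ?P1 = "relabel lift_down p1"
  let ?TM = "relabel lift_up ?o" and ?MB = "relabel lift_down ?o"
  let ?all = "?P2 \<union> ?P1 \<union> ?TM \<union> ?MB"
  have edge: "\<exists>x\<in>map_prod f id ` verts k. \<exists>y\<in>map_prod f id ` verts k. e = {x, y}"
    if e: "e \<in> relabel f ?o" for e f
  proof -
    obtain e' where e': "e' \<in> ?o" "e = map_prod f id ` e'" using e by (auto simp: relabel_def)
    obtain x y where "x \<in> verts k" "y \<in> verts k" "e' = {x, y}" using id_part_edge[OF e'(1)] by blast
    then show ?thesis using e'(2) by blast
  qed
  have fin: "finite (relabel f ?o)" for f by (simp add: relabel_def id_part_def)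
  have u: "inj_on ?u (verts k)" and d: "inj_on ?d (verts k)"
    by (auto simp: inj_on_def verts_def)
  have uV: "?u ` verts k \<subseteq> levels k" and dV: "?d ` verts k \<subseteq> levels k"
    by (auto simp: verts_def levels_def)
  have "ncomp (levels k) (?P2 \<union> ?P1) + ncomp (?u ` verts k) (?P2 \<union> ?TM)
      \<le> ncomp (?u ` verts k) ?P2 + ncomp (levels k) (?P2 \<union> ?P1 \<union> ?TM)"
    by (rule ncomp_submodular[OF fin _ uV _ edge]) auto
  moreover have "ncomp (levels k) (?P2 \<union> ?P1 \<union> ?TM) + ncomp (?d ` verts k) (?P1 \<union> ?MB)
      \<le> ncomp (?d ` verts k) ?P1 + ncomp (levels k) ?all"
    by (rule ncomp_submodular[OF fin _ dV _ edge]) auto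
  moreover have "ncomp (?u ` verts k) ?P2 = nc p2" "ncomp (?d ` verts k) ?P1 = nc p1"
    using ncomp_relabel[OF _ _ u, of p2] ncomp_relabel[OF _ _ d, of p1] assms
    by (simp_all add: Union_Parts nc_eq_ncomp)
  moreover have "ncomp (?u ` verts k) (?P2 \<union> ?TM) = nc (join_part k p2 ?o)"
    "ncomp (?d ` verts k) (?P1 \<union> ?MB) = nc (join_part k p1 ?o)"
    using ncomp_relabel[OF _ _ u, of "p2 \<union> ?o"] ncomp_relabel[OF _ _ d, of "p1 \<union> ?o"] assms
    by (simp_all add: Union_Parts Union_Parts[OF id_part_in_Parts] nc_join relabel_Un)
  \<comment> \<open>With all identity edges present every middle vertex is linked to an outer one,
    so the outer rows meet every component; there the composition and the identity only use links
    that \<open>?all\<close> has.\<close>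
  moreover have "ncomp (levels k) ?all \<le> ncomp (verts k) (compose k p1 p2 \<union> ?o)"
  proof (rule ncomp_le[where f = id])
    have edge_in: "map_prod f id ` {(Top, i), (Bot, i)} \<in> relabel f ?o" if "i \<in> {1..k}" for f i
      unfolding relabel_def id_part_def using that by (intro imageI)
    have TM: "((Top, i), (Mid, i)) \<in> linked ?all" if "i \<in> {1..k}" for i
      using edge_in[OF that, of lift_up] linked_block[of "{(Top, i), (Mid, i)}" ?all] by simp
    have MB: "((Mid, i), (Bot, i)) \<in> linked ?all" if "i \<in> {1..k}" for i
      using edge_in[OF that, of lift_down] linked_block[of "{(Mid, i), (Bot, i)}" ?all] by simp
    show "\<exists>a\<in>verts k. (v, id a) \<in> linked ?all" if v_in: "v \<in> levels k" for v
    proof -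
      obtain l i where v: "v = (l, i)" "i \<in> {1..k}" using v_in by (auto simp: levels_def)
      show ?thesis
      proof (cases "l = Mid")
        case True
        then show ?thesis using v MB[of i] by (intro bexI[of _ "(Bot, i)"]) (auto simp: verts_def)
      next
        case False
        then show ?thesis using v v_in by (intro bexI[of _ v]) (auto simp: verts_def levels_def)
      qed
    qed
    have "linked (compose k p1 p2 \<union> ?o) \<subseteq> linked ?all"
    proof (rule linked_subset)
      fix b x y assume b: "b \<in> compose k p1 p2 \<union> ?o" and xy: "x \<in> b" "y \<in> b"
      show "(x, y) \<in> linked ?all"
      proof (cases "b \<in> ?o")
        case True
        then obtain i where "i \<in> {1..k}" "b = {(Top, i), (Bot, i)}" by (auto simp: id_part_def)
        then show ?thesis using xy linked_trans[OF TM MB] linked_sym[OF linked_trans[OF TM MB]] by auto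
      next
        case False
        then obtain c where c: "c \<in> stack k p1 p2" "x \<in> c" "y \<in> c" using b xy by (auto simp: compose_def)
        then have "y \<in> component (levels k) (?P2 \<union> ?P1) x"
          using comps_memD[of c _ _ x] unfolding stack_eq by metis
        then have "(x, y) \<in> linked (?P2 \<union> ?P1)" by (simp add: component_def)
        then show ?thesis using linked_mono[of "?P2 \<union> ?P1" ?all] by auto
      qed
    qed
    then show "(id a, id b) \<in> linked ?all" if "(a, b) \<in> linked (compose k p1 p2 \<union> ?o)" for a b
      using that by auto
  qed (auto simp: verts_def levels_def)
  ultimately show ?thesis using nc_compose[OF assms] by (simp add: nc_join)
qed

lemma nc_id_part: "nc (id_part k) = k"
proof -
  have "inj_on (\<lambda>i. {(Top, i), (Bot, i)}) {1..k}" by (auto simp: inj_on_def doubleton_eq_iff)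
  then show ?thesis unfolding nc_def id_part_def by (subst card_image) auto
qed

lemma transp_transp: "p \<in> Parts k \<Longrightarrow> transp (transp p) = p"
  unfolding transp_def relabel_relabel by (rule relabel_ident) auto

lemma nc_join_transp:
  assumes "p \<in> Parts k" "q \<in> Parts k"
  shows "nc (join_part k (transp p) (transp q)) = nc (join_part k p q)"
proof -
  let ?t = "\<lambda>l. case l of Top \<Rightarrow> Bot | Bot \<Rightarrow> Top | Mid \<Rightarrow> Mid"
  have "inj_on (map_prod ?t id) (verts k)"
    by (auto simp: inj_on_def verts_def)
  moreover have "map_prod ?t id ` verts k = verts k"
    unfolding verts_def by (intro map_prod_surj_on) auto
  ultimately have "ncomp (verts k) (relabel ?t (p \<union> q)) = ncomp (verts k) (p \<union> q)"
    using ncomp_relabel[of "verts k" "p \<union> q" ?t] assms by (simp add: Union_Parts)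
  then show ?thesis using assms by (simp add: nc_join transp_def[symmetric] relabel_Un)
qed

section \<open>Moments and cumulants of products\<close>

text \<open>The excess \<open>d(id, q) + d(q, p) - d(id, p)\<close>, in which the halves cancel. On
  \<open>Parts k\<close> the subtraction does not truncate, by \<open>nc_triangle\<close>, so it can
  serve as an exponent of N.\<close>

definition order_defect :: "nat \<Rightarrow> diagram \<Rightarrow> diagram \<Rightarrow> nat" where
  "order_defect k q p = nc q + nc (join_part k p (id_part k))
    - (nc (join_part k q (id_part k)) + nc (join_part k q p))"

text \<open>The difference of the two sides of the equation in \<open>Kset\<close>; the terms in k
  and the halves cancel. \<open>nc_compose_le\<close> prevents truncation on
  \<open>Parts k\<close>.\<close>

definition compose_defect :: "nat \<Rightarrow> diagram \<Rightarrow> diagram \<Rightarrow> nat" where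
  "compose_defect k p1 p2 = nc p1 + nc p2 + nc (join_part k (compose k p1 p2) (id_part k))
    - (nloops k p1 p2 + nc (compose k p1 p2) + nc (join_part k p1 (id_part k)) + nc (join_part k p2 (id_part k)))"

lemma order_defect_add:
  assumes "q \<in> Parts k" "p \<in> Parts k"
  shows "order_defect k q p + nc (join_part k q (id_part k)) + nc (join_part k q p)
    = nc q + nc (join_part k p (id_part k))"
  using nc_triangle[OF assms(2,1)] by (simp add: order_defect_def)

lemma compose_defect_add:
  assumes "p1 \<in> Parts k" "p2 \<in> Parts k"
  shows "compose_defect k p1 p2 + nloops k p1 p2 + nc (compose k p1 p2)
      + nc (join_part k p1 (id_part k)) + nc (join_part k p2 (id_part k))
    = nc p1 + nc p2 + nc (join_part k (compose k p1 p2) (id_part k))"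
  using nc_compose_le[OF assms] by (simp add: compose_defect_def)

lemma geodesic_le_iff:
  assumes "q \<in> Parts k" "p \<in> Parts k"
  shows "geodesic_le k q p \<longleftrightarrow> order_defect k q p = 0"
proof -
  have "real (order_defect k q p) + nc (join_part k q (id_part k)) + nc (join_part k q p)
      = nc q + nc (join_part k p (id_part k))"
    using order_defect_add[OF assms] by (metis of_nat_add)
  then show ?thesis
    using assms join_part_commute[of "id_part k" k]
    by (simp add: geodesic_le_def part_dist_def field_simps) linarith
qed

lemma Kset_iff:
  assumes "p1 \<in> Parts k" "p2 \<in> Parts k"
  shows "p2 \<in> Kset k p p1 \<longleftrightarrow> p = compose k p1 p2 \<and> compose_defect k p1 p2 = 0"
proof -
  have "real (compose_defect k p1 p2) + nloops k p1 p2 + nc (compose k p1 p2)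
      + nc (join_part k p1 (id_part k)) + nc (join_part k p2 (id_part k))
    = nc p1 + nc p2 + nc (join_part k (compose k p1 p2) (id_part k))"
    using compose_defect_add[OF assms] by (metis of_nat_add)
  note defect = this
  have join: "join_part k (id_part k) q = join_part k q (id_part k)" if "q \<in> Parts k" for q
    using that by (simp add: join_part_commute)
  show ?thesis
  proof (cases "p = compose k p1 p2")
    case True
    show ?thesis
      using assms defect unfolding Kset_def part_dist_def nc_id_part True
      by (simp add: join) (auto simp: field_simps)
  qed (simp add: Kset_def)
qed

text \<open>Distance to the identity is a strictly increasing height for the geodesic order; this
  gives the induction that inverts the limiting matrix.\<close>

lemma geodesic_le_less:
  assumes "q \<in> Parts k" "p \<in> Parts k" "geodesic_le k q p" "q \<noteq> p"
  shows "part_dist k (id_part k) q < part_dist k (id_part k) p"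
proof -
  have "2 * nc (join_part k q p) < nc q + nc p"
    using nc_join_less[of p k q] assms by simp
  then have "2 * real (nc (join_part k q p)) < real (nc q) + real (nc p)"
    by linarith
  then have "part_dist k q p > 0" by (simp add: part_dist_def field_simps)
  then show ?thesis using assms(3) by (simp add: geodesic_le_def)
qed

lemma geodesic_le_refl: "p \<in> Parts k \<Longrightarrow> geodesic_le k p p"
  by (simp add: geodesic_le_iff order_defect_def nc_join nc_eq_ncomp)

section \<open>Expansions in powers of N\<close>

lemma sum_palg_mult:
  "(\<Sum>s\<in>Parts k. palg_mult k N E F s * g s) =
    (\<Sum>p1\<in>Parts k. \<Sum>p2\<in>Parts k. E p1 * F p2 * of_nat N ^ nloops k p1 p2 * g (compose k p1 p2))"
proof -
  have "(\<Sum>s\<in>Parts k. palg_mult k N E F s * g s) = (\<Sum>s\<in>Parts k. \<Sum>p1\<in>Parts k. \<Sum>p2\<in>Parts k.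
      E p1 * F p2 * of_nat N ^ nloops k p1 p2 * (if s = compose k p1 p2 then g s else 0))"
    unfolding palg_mult_def basis_elt_def sum_distrib_right
    by (intro sum.cong refl) simp
  also have "\<dots> = (\<Sum>p1\<in>Parts k. \<Sum>p2\<in>Parts k. \<Sum>s\<in>Parts k.
      E p1 * F p2 * of_nat N ^ nloops k p1 p2 * (if s = compose k p1 p2 then g s else 0))"
    by (subst sum.swap) (intro sum.cong refl sum.swap)
  finally show ?thesis by (simp flip: sum_distrib_left)
qed

lemma sum_basis_elt: "p \<in> Parts k \<Longrightarrow> (\<Sum>q\<in>Parts k. basis_elt p q * g q) = g p"
proof -
  assume "p \<in> Parts k"
  have "(\<Sum>q\<in>Parts k. basis_elt p q * g q) = (\<Sum>q\<in>Parts k. if q = p then g q else 0)"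
    by (intro sum.cong) (auto simp: basis_elt_def)
  with \<open>p \<in> Parts k\<close> show ?thesis by simp
qed

text \<open>The loops created by multiplying with \<open>transp p\<close> and the trace of the
  composition combine, by \<open>nc_close\<close>, into the single exponent of the join.\<close>

lemma moment_eq:
  assumes "p \<in> Parts k"
  shows "moment k N p E = (\<Sum>q\<in>Parts k. E q * of_nat N ^ nc (join_part k q p))
    / of_nat N ^ nc (join_part k p (id_part k))"
proof -
  have "Tr k N (palg_mult k N E (basis_elt (transp p))) =
      (\<Sum>q\<in>Parts k. \<Sum>r\<in>Parts k. basis_elt (transp p) r * (E q * of_nat N ^ nloops k q r
        * of_nat N ^ nc (join_part k (compose k q r) (id_part k))))"
    unfolding Tr_def sum_palg_mult by (simp add: mult_ac)
  also have "\<dots> = (\<Sum>q\<in>Parts k. E q * of_nat N ^ nc (join_part k q p))"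
  proof (rule sum.cong)
    fix q assume "q \<in> Parts k"
    then have "nc (join_part k q p) = nloops k q (transp p) + nc (join_part k (compose k q (transp p)) (id_part k))"
      using assms by (simp add: nc_close)
    then show "(\<Sum>r\<in>Parts k. basis_elt (transp p) r * (E q * of_nat N ^ nloops k q r
        * of_nat N ^ nc (join_part k (compose k q r) (id_part k)))) = E q * of_nat N ^ nc (join_part k q p)"
      using sum_basis_elt[of "transp p" k] assms by (simp add: power_add)
  qed simp
  finally show ?thesis using assms by (simp add: moment_def Tr_def sum_basis_elt)
qed

lemma cumulant_eq:
  "N \<ge> 1 \<Longrightarrow> cumulant k N p E = of_nat N ^ nc p / of_nat N ^ nc (join_part k p (id_part k)) * E p"
  by (simp add: cumulant_def power_int_diff)

lemma moment_eq_cumulants: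
  assumes "p \<in> Parts k" "N \<ge> 1"
  shows "moment k N p E = (\<Sum>q\<in>Parts k. cumulant k N q E / of_nat N ^ order_defect k q p)"
proof -
  have "E q * of_nat N ^ nc (join_part k q p) / of_nat N ^ nc (join_part k p (id_part k))
      = cumulant k N q E / of_nat N ^ order_defect k q p" if "q \<in> Parts k" for q
  proof -
    have "(of_nat N :: complex) ^ (order_defect k q p + nc (join_part k q (id_part k)) + nc (join_part k q p))
        = of_nat N ^ (nc q + nc (join_part k p (id_part k)))"
      by (simp only: order_defect_add[OF that assms(1)])
    then show ?thesis
      using assms(2) by (simp add: cumulant_eq power_add field_simps)
  qed
  then show ?thesis using assms(1) by (simp add: moment_eq sum_divide_distrib)
qed

lemma cumulant_palg_mult:
  assumes "p \<in> Parts k" "N \<ge> 1"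
  shows "cumulant k N p (palg_mult k N E F) = (\<Sum>p1\<in>Parts k. \<Sum>p2\<in>Parts k.
    if compose k p1 p2 = p then cumulant k N p1 E * cumulant k N p2 F / of_nat N ^ compose_defect k p1 p2 else 0)"
proof -
  have "of_nat N ^ nc p / of_nat N ^ nc (join_part k p (id_part k)) *
      (E p1 * F p2 * (of_nat N ^ nloops k p1 p2 * basis_elt (compose k p1 p2) p)) =
      (if compose k p1 p2 = p then cumulant k N p1 E * cumulant k N p2 F / of_nat N ^ compose_defect k p1 p2 else 0)"
    if "p1 \<in> Parts k" "p2 \<in> Parts k" for p1 p2
  proof (cases "compose k p1 p2 = p")
    case True
    have "(of_nat N :: complex) ^ (compose_defect k p1 p2 + nloops k p1 p2 + nc p
          + nc (join_part k p1 (id_part k)) + nc (join_part k p2 (id_part k)))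
        = of_nat N ^ (nc p1 + nc p2 + nc (join_part k p (id_part k)))"
      using compose_defect_add[OF that] True by simp
    then show ?thesis
      using assms(2) True by (simp add: cumulant_eq basis_elt_def power_add field_simps)
  qed (simp add: basis_elt_def)
  then show ?thesis
    using assms(2) unfolding cumulant_eq[OF assms(2), of k p] palg_mult_def sum_distrib_left
    by (intro sum.cong refl)
qed

text \<open>The rotation identity and the closure identity both contain the loops of
  \<open>transp p1\<close> under \<open>p\<close>. These cancel, and the exponent left after
  normalising both factors is \<open>order_defect k p1 p\<close>.\<close>

lemma moment_palg_mult_left:
  assumes "p \<in> Parts k" "N \<ge> 1"
  shows "moment k N p (palg_mult k N E F) = (\<Sum>p1\<in>Parts k.
    cumulant k N p1 E * moment k N (compose k (transp p1) p) F / of_nat N ^ order_defect k p1 p)"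
proof -
  let ?n = "of_nat N :: complex" and ?o = "id_part k"
  have "E p1 * F p2 * ?n ^ nloops k p1 p2 * ?n ^ nc (join_part k (compose k p1 p2) p) / ?n ^ nc (join_part k p ?o)
      = cumulant k N p1 E * (F p2 * ?n ^ nc (join_part k p2 (compose k (transp p1) p))
        / ?n ^ nc (join_part k (compose k (transp p1) p) ?o)) / ?n ^ order_defect k p1 p"
    if P: "p1 \<in> Parts k" "p2 \<in> Parts k" for p1 p2
  proof -
    \<comment> \<open>Closure is applied to the two transposes: \<open>nc_close\<close> transposes
      its second diagram back, and transposing both leaves the join count unchanged.\<close>
    have "nloops k (transp p1) p + nc (join_part k (compose k (transp p1) p) ?o) = nc (join_part k p1 p)"
      using nc_close[of "transp p1" k "transp p"] nc_join_transp[of p1 k p] P assms(1)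
      by (simp add: transp_transp)
    then have "order_defect k p1 p + nc (join_part k p1 ?o) + nloops k p1 p2 + nc (join_part k (compose k p1 p2) p)
          + nc (join_part k (compose k (transp p1) p) ?o)
        = nc p1 + nc (join_part k p ?o) + nc (join_part k p2 (compose k (transp p1) p))"
      using nc_rotate_left[OF P assms(1)] order_defect_add[OF P(1) assms(1)] by linarith
    then have "?n ^ (order_defect k p1 p + nc (join_part k p1 ?o) + nloops k p1 p2 + nc (join_part k (compose k p1 p2) p)
          + nc (join_part k (compose k (transp p1) p) ?o))
        = ?n ^ (nc p1 + nc (join_part k p ?o) + nc (join_part k p2 (compose k (transp p1) p)))"
      by (rule arg_cong)
    then show ?thesis
      using assms(2) by (simp add: cumulant_eq power_add field_simps)
  qed
  then show ?thesis
    using assms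
    by (simp add: moment_eq sum_palg_mult sum_divide_distrib sum_distrib_left)
qed

lemma moment_palg_mult_right:
  assumes "p \<in> Parts k" "N \<ge> 1"
  shows "moment k N p (palg_mult k N E F) = (\<Sum>p2\<in>Parts k.
    moment k N (compose k p (transp p2)) E * cumulant k N p2 F / of_nat N ^ order_defect k p2 p)"
proof -
  let ?n = "of_nat N :: complex" and ?o = "id_part k"
  have step: "E p1 * F p2 * ?n ^ nloops k p1 p2 * ?n ^ nc (join_part k (compose k p1 p2) p) / ?n ^ nc (join_part k p ?o)
      = E p1 * ?n ^ nc (join_part k p1 (compose k p (transp p2)))
        / ?n ^ nc (join_part k (compose k p (transp p2)) ?o) * cumulant k N p2 F / ?n ^ order_defect k p2 p"
    if P: "p2 \<in> Parts k" "p1 \<in> Parts k" for p1 p2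
  proof -
    have "nloops k p (transp p2) + nc (join_part k (compose k p (transp p2)) ?o) = nc (join_part k p2 p)"
      using nc_close[of p k p2] P assms(1) join_part_commute[of p2 k p] by simp
    then have "order_defect k p2 p + nc (join_part k p2 ?o) + nloops k p1 p2 + nc (join_part k (compose k p1 p2) p)
          + nc (join_part k (compose k p (transp p2)) ?o)
        = nc p2 + nc (join_part k p ?o) + nc (join_part k p1 (compose k p (transp p2)))"
      using nc_rotate_right[OF P(2,1) assms(1)] order_defect_add[OF P(1) assms(1)] by linarith
    then have "?n ^ (order_defect k p2 p + nc (join_part k p2 ?o) + nloops k p1 p2 + nc (join_part k (compose k p1 p2) p)
          + nc (join_part k (compose k p (transp p2)) ?o))
        = ?n ^ (nc p2 + nc (join_part k p ?o) + nc (join_part k p1 (compose k p (transp p2))))"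
      by (rule arg_cong)
    then show ?thesis
      using assms(2) by (simp add: cumulant_eq power_add field_simps)
  qed
  have "moment k N p (palg_mult k N E F) = (\<Sum>p1\<in>Parts k. \<Sum>p2\<in>Parts k.
      E p1 * F p2 * ?n ^ nloops k p1 p2 * ?n ^ nc (join_part k (compose k p1 p2) p) / ?n ^ nc (join_part k p ?o))"
    using assms by (simp add: moment_eq sum_palg_mult sum_divide_distrib)
  also have "\<dots> = (\<Sum>p1\<in>Parts k. \<Sum>p2\<in>Parts k. E p1 * ?n ^ nc (join_part k p1 (compose k p (transp p2)))
        / ?n ^ nc (join_part k (compose k p (transp p2)) ?o) * cumulant k N p2 F / ?n ^ order_defect k p2 p)"
    by (intro sum.cong refl step)
  \<comment> \<open>The sum over \<open>p1\<close> must be the inner one, since it reassembles the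
    moment of \<open>E\<close>.\<close>
  also have "\<dots> = (\<Sum>p2\<in>Parts k. \<Sum>p1\<in>Parts k. E p1 * ?n ^ nc (join_part k p1 (compose k p (transp p2)))
        / ?n ^ nc (join_part k (compose k p (transp p2)) ?o) * cumulant k N p2 F / ?n ^ order_defect k p2 p)"
    by (rule sum.swap)
  finally show ?thesis
    by (simp add: moment_eq sum_divide_distrib sum_distrib_right)
qed

text \<open>The sum runs over all pairs, with the indicator that is the limit of the inverse power
  of N given by the defect; limits can then be taken term by term.\<close>

lemma boxconv_eq:
  "boxconv k \<phi> \<psi> p = (\<Sum>p1\<in>Parts k. \<Sum>p2\<in>Parts k.
    if compose k p1 p2 = p then \<phi> p1 * \<psi> p2 * (if compose_defect k p1 p2 = 0 then 1 else 0) else 0)"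
proof -
  have "boxconv k \<phi> \<psi> p = (\<Sum>(p1, p2)\<in>Parts k \<times> Parts k.
      if compose k p1 p2 = p \<and> p2 \<in> Kset k p p1 then \<phi> p1 * \<psi> p2 else 0)"
    unfolding boxconv_def by (rule sum.mono_neutral_cong_left) (auto split: if_splits)
  also have "\<dots> = (\<Sum>p1\<in>Parts k. \<Sum>p2\<in>Parts k.
      if compose k p1 p2 = p \<and> p2 \<in> Kset k p p1 then \<phi> p1 * \<psi> p2 else 0)"
    by (simp add: sum.cartesian_product)
  also have "\<dots> = (\<Sum>p1\<in>Parts k. \<Sum>p2\<in>Parts k.
    if compose k p1 p2 = p then \<phi> p1 * \<psi> p2 * (if compose_defect k p1 p2 = 0 then 1 else 0) else 0)"
    by (intro sum.cong refl) (simp add: Kset_iff)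
  finally show ?thesis .
qed

lemma boxconv_d_eq:
  assumes "p \<in> Parts k"
  shows "boxconv_d k \<phi> \<psi> p = (\<Sum>p1\<in>Parts k.
    \<phi> p1 * \<psi> (compose k (transp p1) p) * (if order_defect k p1 p = 0 then 1 else 0))"
  unfolding boxconv_d_def
  by (rule sum.mono_neutral_cong_left) (auto simp: geodesic_le_iff assms)

lemma boxconv_g_eq:
  assumes "p \<in> Parts k"
  shows "boxconv_g k \<phi> \<psi> p = (\<Sum>p1\<in>Parts k.
    \<phi> (compose k p (transp p1)) * \<psi> p1 * (if order_defect k p1 p = 0 then 1 else 0))"
  unfolding boxconv_g_def
  by (rule sum.mono_neutral_cong_left) (auto simp: geodesic_le_iff assms)

lemma tendsto_inverse_power_of_nat:
  "(\<lambda>N. 1 / of_nat N ^ d :: complex) \<longlonglongrightarrow> (if d = 0 then 1 else 0)"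
proof (cases "d = 0")
  case False
  have "(\<lambda>N. (1 / of_nat N :: complex) ^ d) \<longlonglongrightarrow> 0 ^ d"
    by (intro tendsto_power lim_1_over_n)
  then show ?thesis using False by (simp add: power_one_over power_0_left)
qed simp

section \<open>Limits of linear differential equations\<close>

lemma DERIV_norm_power2:
  fixes u :: "real \<Rightarrow> complex"
  assumes "(u has_vector_derivative u') (at t within S)"
  shows "((\<lambda>t. (norm (u t))\<^sup>2) has_real_derivative 2 * (u t \<bullet> u')) (at t within S)"
proof -
  have "((\<lambda>t. u t \<bullet> u t) has_vector_derivative (u t \<bullet> u' + u' \<bullet> u t)) (at t within S)"
    by (rule bounded_bilinear.has_vector_derivative[OF bounded_bilinear_inner assms assms])
  then show ?thesis
    by (simp add: has_real_derivative_iff_has_vector_derivative power2_norm_eq_inner inner_commute)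
qed

text \<open>The function \<open>(\<Sum>p. \<bar>u p\<bar>\<^sup>2) * exp (- c * t) - \<epsilon>\<^sup>2 * t\<close> is nonincreasing.\<close>

lemma gronwall_estimate:
  fixes u u' :: "real \<Rightarrow> 'i \<Rightarrow> complex"
  assumes "finite P" "0 \<le> L" "0 \<le> \<epsilon>"
    and deriv: "\<And>t p. 0 \<le> t \<Longrightarrow> p \<in> P \<Longrightarrow>
      ((\<lambda>t. u t p) has_vector_derivative u' t p) (at t within {0..})"
    and bound: "\<And>t p. 0 \<le> t \<Longrightarrow> t \<le> T \<Longrightarrow> p \<in> P \<Longrightarrow>
      norm (u' t p) \<le> L * (\<Sum>q\<in>P. norm (u t q)) + \<epsilon>"
    and t: "0 \<le> t" "t \<le> T" and p: "p \<in> P"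
  shows "norm (u t p) \<le> exp ((2 * L + 1) * card P * T) * ((\<Sum>q\<in>P. norm (u 0 q)) + \<epsilon> * (1 + T))"
proof -
  \<comment> \<open>\<open>2 * s * \<epsilon>\<close> is at most the sum of the squares of
    \<open>s\<close> and \<open>\<epsilon>\<close>, which turns \<open>2 * L\<close> into
    \<open>2 * L + 1\<close>; Cauchy-Schwarz bounds the square of \<open>s\<close> by
    \<open>card P * S\<close>.\<close>
  define c where "c = (2 * L + 1) * card P"
  \<comment> \<open>Squared norms stay differentiable where a coordinate vanishes; norms need
    not.\<close>
  define S where "S = (\<lambda>t. \<Sum>p\<in>P. (norm (u t p))\<^sup>2)"
  define s where "s = (\<lambda>t. \<Sum>p\<in>P. norm (u t p))"
  define S' where "S' = (\<lambda>t. \<Sum>p\<in>P. 2 * (u t p \<bullet> u' t p))"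
  define g where "g = (\<lambda>t. exp (- c * t) * S t - \<epsilon>\<^sup>2 * t)"
  define g' where "g' = (\<lambda>t. exp (- c * t) * S' t - c * exp (- c * t) * S t - \<epsilon>\<^sup>2)"
  have c0: "c \<ge> 0" using assms(2) by (simp add: c_def)
  have s0: "s t \<ge> 0" for t by (simp add: s_def sum_nonneg)
  have dS: "(S has_real_derivative S' t) (at t within {0..})" if "0 \<le> t" for t
    unfolding S_def S'_def using that by (intro DERIV_sum DERIV_norm_power2 deriv)
  have dg: "(g has_real_derivative g' t) (at t within {0..})" if "0 \<le> t" for t
    unfolding g_def g'_def by (rule derivative_eq_intros dS[OF that] refl | simp add: algebra_simps)+
  have "S' t \<le> c * S t + \<epsilon>\<^sup>2" if "0 \<le> t" "t \<le> T" for t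
  proof -
    have "S' t \<le> (\<Sum>p\<in>P. 2 * (norm (u t p) * (L * s t + \<epsilon>)))"
      unfolding S'_def
    proof (intro sum_mono mult_left_mono)
      fix p assume "p \<in> P"
      have "u t p \<bullet> u' t p \<le> norm (u t p) * norm (u' t p)" by (rule norm_cauchy_schwarz)
      also have "\<dots> \<le> norm (u t p) * (L * s t + \<epsilon>)"
        using bound[OF that \<open>p \<in> P\<close>] by (intro mult_left_mono) (auto simp: s_def)
      finally show "u t p \<bullet> u' t p \<le> norm (u t p) * (L * s t + \<epsilon>)" .
    qed simp
    also have "\<dots> = 2 * s t * (L * s t + \<epsilon>)"
      by (simp add: s_def sum_distrib_left sum_distrib_right mult_ac)
    also have "\<dots> \<le> (2 * L + 1) * (s t)\<^sup>2 + \<epsilon>\<^sup>2"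
      using zero_le_power2[of "s t - \<epsilon>"] by (simp add: power2_eq_square algebra_simps)
    also have "\<dots> \<le> (2 * L + 1) * (S t * card P) + \<epsilon>\<^sup>2"
      using sum_squared_le_sum_of_squares[of "\<lambda>p. norm (u t p)" P] assms(2)
      by (simp add: s_def S_def mult_left_mono)
    finally show ?thesis by (simp add: c_def mult_ac)
  qed
  then have "exp (- c * t) * S' t \<le> exp (- c * t) * (c * S t + \<epsilon>\<^sup>2)" if "0 \<le> t" "t \<le> T" for t
    using that by (intro mult_left_mono) auto
  moreover have "exp (- c * t) * \<epsilon>\<^sup>2 \<le> \<epsilon>\<^sup>2" if "0 \<le> t" for t
    using that c0 by (intro mult_left_le_one_le) auto
  ultimately have g'0: "g' t \<le> 0" if "0 \<le> t" "t \<le> T" for t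
    using that by (fastforce simp: g'_def algebra_simps)
  have "g t \<le> g 0"
  proof (rule DERIV_nonpos_imp_decreasing_open[OF t(1)])
    fix x assume x: "0 < x" "x < t"
    \<comment> \<open>Strictly inside the half-line the derivative is two-sided, as the monotonicity
      criterion demands.\<close>
    have "at x within {0..} = at x" using x by (intro at_within_interior) simp
    then show "\<exists>y. (g has_real_derivative y) (at x) \<and> y \<le> 0"
      using dg[of x] g'0[of x] x t by auto
  next
    have "continuous_on {0..} g"
      using dg by (auto intro: DERIV_continuous_on)
    then show "continuous_on {0..t} g" by (rule continuous_on_subset) auto
  qed
  then have "exp (- c * t) * S t \<le> S 0 + \<epsilon>\<^sup>2 * t" by (simp add: g_def)
  then have "exp (c * t) * (exp (- c * t) * S t) \<le> exp (c * t) * (S 0 + \<epsilon>\<^sup>2 * t)"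
    by (intro mult_left_mono) auto
  moreover have "exp (c * t) * (exp (- c * t) * S t) = S t"
    by (simp add: exp_minus field_simps)
  \<comment> \<open>The bound is brought to the form of a square so that the root can be taken at
    the end; squaring the exponential and replacing \<open>t\<close> by the square of
    \<open>1 + T\<close> are crude steps to that end.\<close>
  moreover have "exp (c * t) * (S 0 + \<epsilon>\<^sup>2 * t) \<le> (exp (c * T) * (s 0 + \<epsilon> * (1 + T)))\<^sup>2"
  proof -
    have "exp (c * t) \<le> exp (c * T)" using t c0 by (simp add: mult_left_mono)
    also have "\<dots> \<le> (exp (c * T))\<^sup>2" using t c0 by (simp add: power2_eq_square mult_ge1_I)
    finally have 1: "exp (c * t) \<le> (exp (c * T))\<^sup>2" .
    have "S 0 \<le> (s 0)\<^sup>2"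
    proof -
      have "S 0 \<le> (\<Sum>p\<in>P. norm (u 0 p) * s 0)"
        unfolding S_def s_def power2_eq_square using assms(1)
        by (intro sum_mono mult_left_mono member_le_sum) auto
      then show ?thesis by (simp add: s_def power2_eq_square sum_distrib_right)
    qed
    moreover have "\<epsilon>\<^sup>2 * t \<le> (\<epsilon> * (1 + T))\<^sup>2"
    proof -
      have "t \<le> 1 + 2 * T + T * T" using t mult_nonneg_nonneg[of T T] by linarith
      also have "\<dots> = (1 + T)\<^sup>2" by (simp add: power2_eq_square algebra_simps)
      finally have "t \<le> (1 + T)\<^sup>2" .
      then show ?thesis by (simp add: power_mult_distrib mult_left_mono)
    qed
    moreover have "0 \<le> 2 * (s 0 * (\<epsilon> * (1 + T)))" using s0[of 0] assms(3) t by simp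
    ultimately have 2: "S 0 + \<epsilon>\<^sup>2 * t \<le> (s 0 + \<epsilon> * (1 + T))\<^sup>2"
      unfolding power2_sum by linarith
    have "0 \<le> S 0 + \<epsilon>\<^sup>2 * t" using t by (simp add: S_def sum_nonneg)
    from mult_mono[OF 1 2 _ this] show ?thesis by (simp add: power_mult_distrib)
  qed
  moreover have "(norm (u t p))\<^sup>2 \<le> S t"
    unfolding S_def using assms(1) p by (intro member_le_sum) auto
  ultimately have "(norm (u t p))\<^sup>2 \<le> (exp (c * T) * (s 0 + \<epsilon> * (1 + T)))\<^sup>2" by linarith
  then have "norm (u t p) \<le> exp (c * T) * (s 0 + \<epsilon> * (1 + T))"
    by (rule power2_le_imp_le) (use s0[of 0] assms(3) t in auto)
  then show ?thesis by (simp add: c_def s_def)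
qed

text \<open>Comparing two of the equations by the Gronwall estimate shows that the solutions are uniformly
  Cauchy on bounded time intervals, so the derivatives pass to the limit.\<close>

lemma linear_ode_limit:
  fixes x :: "nat \<Rightarrow> real \<Rightarrow> 'i \<Rightarrow> complex" and A :: "nat \<Rightarrow> 'i \<Rightarrow> 'i \<Rightarrow> complex"
  assumes fin: "finite P"
    and deriv: "\<And>N t p. 0 \<le> t \<Longrightarrow> p \<in> P \<Longrightarrow>
      ((\<lambda>t. x N t p) has_vector_derivative (\<Sum>q\<in>P. A N p q * x N t q)) (at t within {0..})"
    and A: "\<And>p q. p \<in> P \<Longrightarrow> q \<in> P \<Longrightarrow> (\<lambda>N. A N p q) \<longlonglongrightarrow> B p q"
    and x0: "\<And>p. p \<in> P \<Longrightarrow> (\<lambda>N. x N 0 p) \<longlonglongrightarrow> y0 p"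
  obtains y where "\<And>t p. 0 \<le> t \<Longrightarrow> p \<in> P \<Longrightarrow> (\<lambda>N. x N t p) \<longlonglongrightarrow> y t p"
    and "\<And>t p. 0 \<le> t \<Longrightarrow> p \<in> P \<Longrightarrow>
      ((\<lambda>t. y t p) has_vector_derivative (\<Sum>q\<in>P. B p q * y t q)) (at t within {0..})"
proof -
  have sum_bound: "\<exists>K\<ge>0. \<forall>N. (\<Sum>i\<in>I. norm (f N i)) \<le> K"
    if I: "finite I" and lim: "\<And>i. i \<in> I \<Longrightarrow> (\<lambda>N. f N i) \<longlonglongrightarrow> l i"
    for I and f :: "nat \<Rightarrow> 'j \<Rightarrow> complex" and l
  proof -
    have "(\<lambda>N. \<Sum>i\<in>I. norm (f N i)) \<longlonglongrightarrow> (\<Sum>i\<in>I. norm (l i))"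
      using lim by (intro tendsto_intros)
    then have "Bseq (\<lambda>N. \<Sum>i\<in>I. norm (f N i))" by (rule convergent_imp_Bseq[OF convergentI])
    then obtain K where "K > 0" "\<And>N. norm (\<Sum>i\<in>I. norm (f N i)) \<le> K" unfolding Bseq_def by blast
    then show ?thesis by (intro exI[of _ K]) (auto dest: order_trans[OF abs_ge_self])
  qed
  obtain L where L: "L \<ge> 0" "\<And>N. (\<Sum>i\<in>P \<times> P. norm (case i of (p, q) \<Rightarrow> A N p q)) \<le> L"
    using sum_bound[of "P \<times> P" "\<lambda>N (p, q). A N p q" "\<lambda>(p, q). B p q"] fin A by fastforce
  obtain R where R: "R \<ge> 0" "\<And>N. (\<Sum>q\<in>P. norm (x N 0 q)) \<le> R"
    using sum_bound[of P "\<lambda>N q. x N 0 q" y0] fin x0 by blast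
  have AL: "norm (A N p q) \<le> L" if "p \<in> P" "q \<in> P" for N p q
    using member_le_sum[of "(p, q)" "P \<times> P" "\<lambda>i. norm (case i of (p, q) \<Rightarrow> A N p q)"] that fin L(2)[of N]
    by auto
  have A_le: "norm (\<Sum>q\<in>P. A N p q * z q) \<le> L * (\<Sum>q\<in>P. norm (z q))" if "p \<in> P" for N p z
  proof -
    have "norm (\<Sum>q\<in>P. A N p q * z q) \<le> (\<Sum>q\<in>P. L * norm (z q))"
      using AL that by (intro sum_norm_le) (simp add: norm_mult mult_right_mono)
    then show ?thesis by (simp add: sum_distrib_left)
  qed
  \<comment> \<open>One number measures how far the data of index \<open>N\<close> are from the
    limiting data; the error bounds below are constants times \<open>\<theta>\<close>.\<close>
  define \<theta> where "\<theta> N = (\<Sum>q\<in>P. norm (x N 0 q - y0 q)) + (\<Sum>p\<in>P. \<Sum>q\<in>P. norm (A N p q - B p q))" for N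
  have \<theta>_lim: "\<theta> \<longlonglongrightarrow> 0"
    unfolding \<theta>_def using A x0
    by (intro tendsto_add_zero tendsto_null_sum tendsto_norm_zero LIM_zero)
  have \<theta>0: "\<theta> N \<ge> 0" for N by (simp add: \<theta>_def sum_nonneg add_nonneg_nonneg)
  have \<theta>_A: "(\<Sum>q\<in>P. norm (A N p q - B p q)) \<le> \<theta> N" if "p \<in> P" for N p
  proof -
    have "(\<Sum>q\<in>P. norm (A N p q - B p q)) \<le> (\<Sum>p\<in>P. \<Sum>q\<in>P. norm (A N p q - B p q))"
      using fin that by (intro member_le_sum) (auto intro: sum_nonneg)
    moreover have "0 \<le> (\<Sum>q\<in>P. norm (x N 0 q - y0 q))" by (simp add: sum_nonneg)
    ultimately show ?thesis by (simp add: \<theta>_def)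
  qed
  have \<theta>_x: "(\<Sum>q\<in>P. norm (x N 0 q - y0 q)) \<le> \<theta> N" for N
    by (simp add: \<theta>_def sum_nonneg)
  have bounded: "\<exists>M\<ge>0. \<forall>N t. 0 \<le> t \<longrightarrow> t \<le> T \<longrightarrow> (\<forall>p\<in>P. norm (x N t p) \<le> M)" for T
  proof -
    let ?M = "exp ((2 * L + 1) * card P * T) * R"
    have "norm (x N t p) \<le> ?M" if "0 \<le> t" "t \<le> T" "p \<in> P" for N t p
    proof -
      have "norm (x N t p) \<le> exp ((2 * L + 1) * card P * T) * ((\<Sum>q\<in>P. norm (x N 0 q)) + 0 * (1 + T))"
        by (rule gronwall_estimate[OF fin L(1) _ deriv _ that]) (use A_le in auto)
      also have "\<dots> \<le> ?M" using R(2)[of N] by (intro mult_left_mono) auto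
      finally show ?thesis .
    qed
    then show ?thesis using R(1) by (intro exI[of _ ?M]) auto
  qed
  have cauchy: "\<exists>C\<ge>0. \<forall>N M t. 0 \<le> t \<longrightarrow> t \<le> T \<longrightarrow> (\<forall>p\<in>P. norm (x N t p - x M t p) \<le> C * (\<theta> N + \<theta> M))"
    for T
  proof (cases "T \<ge> 0")
    case T: True
    obtain K where K: "K \<ge> 0" "\<And>N t p. 0 \<le> t \<Longrightarrow> t \<le> T \<Longrightarrow> p \<in> P \<Longrightarrow> norm (x N t p) \<le> K"
      using bounded[of T] by blast
    \<comment> \<open>The \<open>1\<close> accounts for the initial values,
      \<open>K * (1 + T)\<close> for the forcing term.\<close>
    let ?C = "exp ((2 * L + 1) * card P * T) * (1 + K * (1 + T))"
    have "norm (x N t p - x M t p) \<le> ?C * (\<theta> N + \<theta> M)" if t: "0 \<le> t" "t \<le> T" "p \<in> P" for N M t p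
    proof -
      have "norm (x N t p - x M t p) \<le> exp ((2 * L + 1) * card P * T) *
          ((\<Sum>q\<in>P. norm (x N 0 q - x M 0 q)) + K * (\<theta> N + \<theta> M) * (1 + T))"
      proof (rule gronwall_estimate[OF fin L(1) _ has_vector_derivative_diff[OF deriv deriv] _ t])
        fix t p assume t: "0 \<le> t" "t \<le> T" "p \<in> P"
        \<comment> \<open>The difference of two solutions solves the equation with matrix
          \<open>A N\<close> and a forcing term, the difference of the matrices applied to the
          bounded \<open>x M\<close>.\<close>
        have "(\<Sum>q\<in>P. A N p q * x N t q) - (\<Sum>q\<in>P. A M p q * x M t q) =
            (\<Sum>q\<in>P. A N p q * (x N t q - x M t q)) + (\<Sum>q\<in>P. (A N p q - A M p q) * x M t q)"
          by (simp add: sum.distrib[symmetric] sum_subtractf[symmetric] algebra_simps)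
        moreover have "norm (\<Sum>q\<in>P. (A N p q - A M p q) * x M t q) \<le> K * (\<theta> N + \<theta> M)"
        proof -
          have "norm (\<Sum>q\<in>P. (A N p q - A M p q) * x M t q) \<le>
              (\<Sum>q\<in>P. (norm (A N p q - B p q) + norm (A M p q - B p q)) * K)"
          proof (rule sum_norm_le)
            fix q assume "q \<in> P"
            have "norm (A N p q - A M p q) \<le> norm (A N p q - B p q) + norm (A M p q - B p q)"
              using norm_triangle_ineq4[of "A N p q - B p q" "A M p q - B p q"] by simp
            then show "norm ((A N p q - A M p q) * x M t q)
                \<le> (norm (A N p q - B p q) + norm (A M p q - B p q)) * K"
              unfolding norm_mult using K(2)[OF t(1,2) \<open>q \<in> P\<close>] by (intro mult_mono) auto
          qed
          also have "\<dots> = ((\<Sum>q\<in>P. norm (A N p q - B p q)) + (\<Sum>q\<in>P. norm (A M p q - B p q))) * K"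
            by (simp add: sum.distrib sum_distrib_right distrib_right)
          also have "\<dots> \<le> (\<theta> N + \<theta> M) * K"
            using \<theta>_A[OF t(3)] K(1) by (intro mult_right_mono add_mono) auto
          finally show ?thesis by (simp add: mult.commute)
        qed
        ultimately show "norm ((\<Sum>q\<in>P. A N p q * x N t q) - (\<Sum>q\<in>P. A M p q * x M t q))
            \<le> L * (\<Sum>q\<in>P. norm (x N t q - x M t q)) + K * (\<theta> N + \<theta> M)"
          using A_le[OF t(3), of N "\<lambda>q. x N t q - x M t q"] by (smt (verit) norm_triangle_ineq)
      qed (use K \<theta>0 in auto)
      also have "\<dots> \<le> exp ((2 * L + 1) * card P * T) * ((\<theta> N + \<theta> M) + K * (\<theta> N + \<theta> M) * (1 + T))"
      proof (intro mult_left_mono add_right_mono)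
        have "(\<Sum>q\<in>P. norm (x N 0 q - x M 0 q)) \<le>
            (\<Sum>q\<in>P. norm (x N 0 q - y0 q) + norm (x M 0 q - y0 q))"
        proof (rule sum_mono)
          show "norm (x N 0 q - x M 0 q) \<le> norm (x N 0 q - y0 q) + norm (x M 0 q - y0 q)" for q
            using norm_triangle_ineq4[of "x N 0 q - y0 q" "x M 0 q - y0 q"] by simp
        qed
        then show "(\<Sum>q\<in>P. norm (x N 0 q - x M 0 q)) \<le> \<theta> N + \<theta> M"
          using \<theta>_x[of N] \<theta>_x[of M] by (simp add: sum.distrib)
      qed simp
      also have "\<dots> = ?C * (\<theta> N + \<theta> M)" by (simp add: algebra_simps)
      finally show ?thesis .
    qed
    moreover have "?C \<ge> 0" using T K(1) by simp
    ultimately show ?thesis by blast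
  qed (intro exI[of _ 0]; auto)
  define y where "y t p = lim (\<lambda>N. x N t p)" for t p
  have lim_y: "(\<lambda>N. x N t p) \<longlonglongrightarrow> y t p" if t: "0 \<le> t" "p \<in> P" for t p
  proof -
    obtain C where C: "C \<ge> 0" "\<And>N M. norm (x N t p - x M t p) \<le> C * (\<theta> N + \<theta> M)"
      using cauchy[of t] t by blast
    have "(\<lambda>N. C * \<theta> N) \<longlonglongrightarrow> C * 0" by (intro tendsto_mult_left \<theta>_lim)
    then have "Cauchy (\<lambda>N. x N t p)"
    proof (intro CauchyI)
      fix e :: real assume "e > 0"
      then have "\<forall>\<^sub>F N in sequentially. C * \<theta> N < e / 2"
        using order_tendstoD(2)[OF \<open>(\<lambda>N. C * \<theta> N) \<longlonglongrightarrow> C * 0\<close>, of "e / 2"] by simp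
      then obtain N0 where "\<And>N. N \<ge> N0 \<Longrightarrow> C * \<theta> N < e / 2" by (auto simp: eventually_sequentially)
      then have "norm (x m t p - x n t p) < e" if "m \<ge> N0" "n \<ge> N0" for m n
        using C(2)[of m n] that by (smt (verit) distrib_left field_sum_of_halves)
      then show "\<exists>M. \<forall>m\<ge>M. \<forall>n\<ge>M. norm (x m t p - x n t p) < e" by blast
    qed
    then show ?thesis
      unfolding y_def by (simp add: Cauchy_convergent_iff convergent_LIMSEQ_iff)
  qed
  moreover have "((\<lambda>t. y t p) has_vector_derivative (\<Sum>q\<in>P. B p q * y t q)) (at t within {0..})"
    if t: "0 \<le> t" and p: "p \<in> P" for t p
  proof -
    \<comment> \<open>Uniform convergence holds on bounded intervals only. Going one unit beyond
      \<open>t\<close> suffices, because \<open>{0..T}\<close> and \<open>{0..}\<close> coincide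
      near \<open>t\<close>.\<close>
    define T where "T = t + 1"
    obtain K where K: "K \<ge> 0" "\<And>N t p. 0 \<le> t \<Longrightarrow> t \<le> T \<Longrightarrow> p \<in> P \<Longrightarrow> norm (x N t p) \<le> K"
      using bounded[of T] by blast
    obtain C where C: "C \<ge> 0"
      "\<And>N M t p. 0 \<le> t \<Longrightarrow> t \<le> T \<Longrightarrow> p \<in> P \<Longrightarrow> norm (x N t p - x M t p) \<le> C * (\<theta> N + \<theta> M)"
      using cauchy[of T] by blast
    have yK: "norm (y s q) \<le> K" if "0 \<le> s" "s \<le> T" "q \<in> P" for s q
      using K(2)[OF that] tendsto_norm[OF lim_y[OF that(1,3)]]
      by (intro LIMSEQ_le_const2) auto
    \<comment> \<open>Letting \<open>M\<close> tend to infinity turns the Cauchy estimate into a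
      rate of convergence.\<close>
    have xy: "norm (x N s q - y s q) \<le> C * \<theta> N" if "0 \<le> s" "s \<le> T" "q \<in> P" for N s q
    proof (rule LIMSEQ_le)
      show "(\<lambda>M. norm (x N s q - x M s q)) \<longlonglongrightarrow> norm (x N s q - y s q)"
        using lim_y that by (intro tendsto_intros)
      have "(\<lambda>M. C * (\<theta> N + \<theta> M)) \<longlonglongrightarrow> C * (\<theta> N + 0)" by (intro tendsto_intros \<theta>_lim)
      then show "(\<lambda>M. C * (\<theta> N + \<theta> M)) \<longlonglongrightarrow> C * \<theta> N" by simp
      show "\<exists>n0. \<forall>M\<ge>n0. norm (x N s q - x M s q) \<le> C * (\<theta> N + \<theta> M)" using C(2)[OF that] by blast
    qed
    \<comment> \<open>\<open>L * card P * C\<close> comes from the error of the solution,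
      \<open>K\<close> from the error of the matrix.\<close>
    define D where "D = L * card P * C + K"
    have D0: "D \<ge> 0" using L(1) C(1) K(1) by (simp add: D_def)
    have unif: "norm ((\<Sum>q\<in>P. A N p q * x N s q) - (\<Sum>q\<in>P. B p q * y s q)) \<le> D * \<theta> N"
      if s: "0 \<le> s" "s \<le> T" for N s
    proof -
      have "(\<Sum>q\<in>P. A N p q * x N s q) - (\<Sum>q\<in>P. B p q * y s q) =
          (\<Sum>q\<in>P. A N p q * (x N s q - y s q)) + (\<Sum>q\<in>P. (A N p q - B p q) * y s q)"
        by (simp add: sum.distrib[symmetric] sum_subtractf[symmetric] algebra_simps)
      moreover have "norm (\<Sum>q\<in>P. A N p q * (x N s q - y s q)) \<le> L * card P * C * \<theta> N"
      proof -
        have "(\<Sum>q\<in>P. norm (x N s q - y s q)) \<le> (\<Sum>q\<in>P. C * \<theta> N)"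
          using xy[OF s] by (rule sum_mono)
        then have "L * (\<Sum>q\<in>P. norm (x N s q - y s q)) \<le> L * (card P * (C * \<theta> N))"
          using L(1) by (intro mult_left_mono) auto
        then show ?thesis using A_le[OF p, of N "\<lambda>q. x N s q - y s q"] by (simp add: mult_ac)
      qed
      moreover have "norm (\<Sum>q\<in>P. (A N p q - B p q) * y s q) \<le> K * \<theta> N"
      proof -
        have "norm (\<Sum>q\<in>P. (A N p q - B p q) * y s q) \<le> (\<Sum>q\<in>P. norm (A N p q - B p q) * K)"
          using yK[OF s] by (intro sum_norm_le) (simp add: norm_mult mult_left_mono)
        also have "\<dots> \<le> \<theta> N * K"
          using \<theta>_A[OF p, of N] K(1) by (simp add: mult_right_mono flip: sum_distrib_right)
        finally show ?thesis by (simp add: mult.commute)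
      qed
      ultimately show ?thesis
        unfolding D_def by (smt (verit) distrib_right norm_triangle_ineq)
    qed
    have "\<exists>g. \<forall>s\<in>{0..T}. (\<lambda>N. x N s p) \<longlonglongrightarrow> g s \<and>
        (g has_derivative (\<lambda>h. h *\<^sub>R (\<Sum>q\<in>P. B p q * y s q))) (at s within {0..T})"
    proof (rule has_derivative_sequence)
      show "((\<lambda>t. x N t p) has_derivative (\<lambda>h. h *\<^sub>R (\<Sum>q\<in>P. A N p q * x N s q))) (at s within {0..T})"
        if "s \<in> {0..T}" for N s
        using has_vector_derivative_within_subset[OF deriv[of s p N], of "{0..T}"] that p
        by (auto simp: has_vector_derivative_def)
      show "\<forall>\<^sub>F N in sequentially. \<forall>s\<in>{0..T}. \<forall>h. norm (h *\<^sub>R (\<Sum>q\<in>P. A N p q * x N s q)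
          - h *\<^sub>R (\<Sum>q\<in>P. B p q * y s q)) \<le> e * norm h" if "e > 0" for e
      proof -
        have "(\<lambda>N. D * \<theta> N) \<longlonglongrightarrow> D * 0" by (intro tendsto_mult_left \<theta>_lim)
        then have "\<forall>\<^sub>F N in sequentially. D * \<theta> N < e"
          using order_tendstoD(2)[of _ "D * 0" _ e] \<open>e > 0\<close> by simp
        then show ?thesis
        proof eventually_elim
          case (elim N)
          show ?case
          proof (intro ballI allI)
            fix s h :: real assume "s \<in> {0..T}"
            then have "norm ((\<Sum>q\<in>P. A N p q * x N s q) - (\<Sum>q\<in>P. B p q * y s q)) \<le> e"
              using unif[of s N] elim by simp
            then show "norm (h *\<^sub>R (\<Sum>q\<in>P. A N p q * x N s q) - h *\<^sub>R (\<Sum>q\<in>P. B p q * y s q)) \<le> e * norm h"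
              by (simp flip: scaleR_diff_right add: mult.commute[of e] mult_left_mono)
          qed
        qed
      qed
      show "(\<lambda>N. x N 0 p) \<longlonglongrightarrow> y 0 p" by (rule lim_y) (use p in auto)
    qed (use t in \<open>auto simp: T_def\<close>)
    then obtain g where g': "\<forall>s\<in>{0..T}. (\<lambda>N. x N s p) \<longlonglongrightarrow> g s \<and>
        (g has_derivative (\<lambda>h. h *\<^sub>R (\<Sum>q\<in>P. B p q * y s q))) (at s within {0..T})" ..
    have g: "(\<lambda>N. x N s p) \<longlonglongrightarrow> g s" if "s \<in> {0..T}" for s
      using g' that by blast
    have "t \<in> {0..T}" using t by (simp add: T_def)
    with g' have dg: "(g has_derivative (\<lambda>h. h *\<^sub>R (\<Sum>q\<in>P. B p q * y t q))) (at t within {0..T})"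
      by blast
    have "y s p = g s" if "s \<in> {0..T}" for s
      using g[OF that] lim_y[of s p] that p by (auto intro: LIMSEQ_unique)
    then have "((\<lambda>t. y t p) has_derivative (\<lambda>h. h *\<^sub>R (\<Sum>q\<in>P. B p q * y t q))) (at t within {0..T})"
      using \<open>t \<in> {0..T}\<close> by (intro has_derivative_transform[OF _ _ dg]) auto
    moreover have "at t within {0..T} = at t within {0..}"
      using t by (intro at_within_nhd[of _ "{..<T}"]) (auto simp: T_def)
    ultimately show ?thesis by (simp add: has_vector_derivative_def)
  qed
  ultimately show ?thesis by (rule that)
qed

section \<open>The limit of the semi-group\<close>

text \<open>\<open>\<zeta>\<close> is the zeta matrix of the geodesic order, with ones on the
  diagonal and otherwise only entries from diagrams strictly closer to the identity. Its left
  inverse is built row by row, and one \<open>\<mu>\<close> serves for every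
  \<open>x\<close>.\<close>

lemma cumulant_left_inverse:
  fixes \<zeta> :: "diagram \<Rightarrow> diagram \<Rightarrow> complex"
  assumes \<zeta>: "\<And>q p. \<zeta> q p = (if order_defect k q p = 0 then 1 else 0)"
  obtains \<mu> where "\<And>x p. p \<in> Parts k \<Longrightarrow> x p = (\<Sum>q\<in>Parts k. \<mu> p q * (\<Sum>r\<in>Parts k. \<zeta> r q * x r))"
proof -
  \<comment> \<open>A natural number in place of the real distance, for well-founded
    induction.\<close>
  define rank where "rank p = card {r \<in> Parts k. part_dist k (id_part k) r < part_dist k (id_part k) p}" for p
  have rank_less: "rank q < rank p"
    if "q \<in> Parts k" "p \<in> Parts k" "order_defect k q p = 0" "q \<noteq> p" for q p
  proof -
    have "part_dist k (id_part k) q < part_dist k (id_part k) p"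
      using geodesic_le_less that by (simp add: geodesic_le_iff)
    then show ?thesis unfolding rank_def using that by (intro psubset_card_mono) auto
  qed
  have diag: "\<zeta> p p = 1" if "p \<in> Parts k" for p
    using geodesic_le_refl[OF that] that by (simp add: geodesic_le_iff \<zeta>)
  have "\<exists>a. \<forall>x. x p = (\<Sum>q\<in>Parts k. a q * (\<Sum>r\<in>Parts k. \<zeta> r q * x r))" if "p \<in> Parts k" for p
    using that
  proof (induction "rank p" arbitrary: p rule: less_induct)
    case less
    let ?R = "{r \<in> Parts k. order_defect k r p = 0 \<and> r \<noteq> p}"
    have "\<forall>r\<in>?R. \<exists>a. \<forall>x. x r = (\<Sum>q\<in>Parts k. a q * (\<Sum>r\<in>Parts k. \<zeta> r q * x r))"
    proof
      fix r assume "r \<in> ?R"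
      then have "rank r < rank p" "r \<in> Parts k" using rank_less[of r p] less.prems by auto
      then show "\<exists>a. \<forall>x. x r = (\<Sum>q\<in>Parts k. a q * (\<Sum>r\<in>Parts k. \<zeta> r q * x r))"
        by (rule less.hyps)
    qed
    from bchoice[OF this] obtain a where
      a: "\<forall>r\<in>?R. \<forall>x. x r = (\<Sum>q\<in>Parts k. a r q * (\<Sum>r\<in>Parts k. \<zeta> r q * x r))" ..
    \<comment> \<open>Row \<open>p\<close> of the inverse: the unit row minus the rows already found
      for the diagrams strictly below \<open>p\<close>.\<close>
    define b where "b q = (if q = p then 1 else 0) - (\<Sum>r\<in>?R. a r q)" for q
    have "x p = (\<Sum>q\<in>Parts k. b q * (\<Sum>r\<in>Parts k. \<zeta> r q * x r))" for x
    proof -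
      define y where "y q = (\<Sum>r\<in>Parts k. \<zeta> r q * x r)" for q
      have "y p = (\<Sum>r\<in>insert p ?R. \<zeta> r p * x r)"
        unfolding y_def using less.prems by (intro sum.mono_neutral_right) (auto simp: \<zeta>)
      also have "\<dots> = x p + (\<Sum>r\<in>?R. x r)"
        using diag[OF less.prems] by (simp add: \<zeta>)
      also have "(\<Sum>r\<in>?R. x r) = (\<Sum>r\<in>?R. \<Sum>q\<in>Parts k. a r q * y q)"
        unfolding y_def by (rule sum.cong[OF refl]) (rule a[rule_format])
      also have "\<dots> = (\<Sum>q\<in>Parts k. (\<Sum>r\<in>?R. a r q) * y q)"
        by (subst sum.swap) (simp add: sum_distrib_right)
      finally have "x p = y p - (\<Sum>q\<in>Parts k. (\<Sum>r\<in>?R. a r q) * y q)" by simp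
      moreover have "y p = (\<Sum>q\<in>Parts k. (if q = p then 1 else 0) * y q)"
      proof -
        have "(\<Sum>q\<in>Parts k. (if q = p then 1 else 0) * y q) = (\<Sum>q\<in>Parts k. if q = p then y q else 0)"
          by (intro sum.cong) auto
        then show ?thesis using less.prems by simp
      qed
      ultimately show ?thesis
        unfolding y_def[symmetric] b_def by (simp only: left_diff_distrib sum_subtractf)
    qed
    then show ?case by (intro exI[of _ b] allI)
  qed
  then have "\<forall>p\<in>Parts k. \<exists>a. \<forall>x. x p = (\<Sum>q\<in>Parts k. a q * (\<Sum>r\<in>Parts k. \<zeta> r q * x r))" ..
  from bchoice[OF this] obtain \<mu> where
    \<mu>: "\<forall>p\<in>Parts k. \<forall>x. x p = (\<Sum>q\<in>Parts k. \<mu> p q * (\<Sum>r\<in>Parts k. \<zeta> r q * x r))" ..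
  show ?thesis by (rule that) (rule \<mu>[rule_format])
qed

text \<open>No bound on \<open>x\<close> is assumed. Once the coefficients sum to less than 1/2,
  \<open>x\<close> can be absorbed into the left-hand side and is bounded by twice the size of
  \<open>y\<close>; the perturbation then tends to zero.\<close>

lemma tendsto_perturbed:
  fixes x y :: "nat \<Rightarrow> 'i \<Rightarrow> complex" and e :: "nat \<Rightarrow> 'i \<Rightarrow> 'i \<Rightarrow> complex"
  assumes fin: "finite P"
    and eq: "\<forall>\<^sub>F N in sequentially. \<forall>p\<in>P. x N p = y N p - (\<Sum>r\<in>P. e N p r * x N r)"
    and e: "\<And>p r. p \<in> P \<Longrightarrow> r \<in> P \<Longrightarrow> (\<lambda>N. e N p r) \<longlonglongrightarrow> 0"
    and y: "\<And>p. p \<in> P \<Longrightarrow> (\<lambda>N. y N p) \<longlonglongrightarrow> l p"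
    and p: "p \<in> P"
  shows "(\<lambda>N. x N p) \<longlonglongrightarrow> l p"
proof -
  define \<epsilon> where "\<epsilon> N = (\<Sum>p\<in>P. \<Sum>r\<in>P. norm (e N p r))" for N
  define Y where "Y N = (\<Sum>p\<in>P. norm (y N p))" for N
  define X where "X N = (\<Sum>p\<in>P. norm (x N p))" for N
  have \<epsilon>: "\<epsilon> \<longlonglongrightarrow> 0"
    unfolding \<epsilon>_def using e by (intro tendsto_null_sum tendsto_norm_zero)
  have Y: "Y \<longlonglongrightarrow> (\<Sum>p\<in>P. norm (l p))"
    unfolding Y_def using y by (intro tendsto_intros)
  have "\<forall>\<^sub>F N in sequentially. X N \<le> 2 * Y N"
    using eq order_tendstoD(2)[OF \<epsilon>, of "1 / 2", simplified]
  proof eventually_elim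
    case (elim N)
    have X0: "X N \<ge> 0" by (simp add: X_def sum_nonneg)
    have "norm (x N p) \<le> norm (y N p) + (\<Sum>r\<in>P. norm (e N p r)) * X N" if "p \<in> P" for p
    proof -
      have "norm (x N p) \<le> norm (y N p) + norm (\<Sum>r\<in>P. e N p r * x N r)"
        using elim(1) that by (metis norm_triangle_ineq4)
      also have "norm (\<Sum>r\<in>P. e N p r * x N r) \<le> (\<Sum>r\<in>P. norm (e N p r) * X N)"
        unfolding X_def using fin
        by (intro sum_norm_le) (auto simp: norm_mult intro!: mult_left_mono member_le_sum)
      finally show ?thesis by (simp add: sum_distrib_right)
    qed
    then have "X N \<le> (\<Sum>p\<in>P. norm (y N p) + (\<Sum>r\<in>P. norm (e N p r)) * X N)"
      unfolding X_def[of N] by (intro sum_mono) (simp add: X_def)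
    also have "\<dots> = Y N + \<epsilon> N * X N"
      by (simp add: Y_def \<epsilon>_def sum.distrib sum_distrib_right)
    also have "\<epsilon> N * X N \<le> 1 / 2 * X N"
      using elim(2) X0 by (intro mult_right_mono) auto
    finally show ?case by simp
  qed
  then have bound: "\<forall>\<^sub>F N in sequentially. norm (x N p - y N p) \<le> \<epsilon> N * (2 * Y N)"
    using eq
  proof eventually_elim
    case (elim N)
    have "norm (x N p - y N p) = norm (\<Sum>r\<in>P. e N p r * x N r)"
      using elim(2) p by (simp add: norm_minus_commute)
    also have "\<dots> \<le> (\<Sum>r\<in>P. norm (e N p r) * (2 * Y N))"
    proof (rule sum_norm_le)
      fix r assume "r \<in> P"
      then have "norm (x N r) \<le> X N" unfolding X_def using fin by (intro member_le_sum) auto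
      then show "norm (e N p r * x N r) \<le> norm (e N p r) * (2 * Y N)"
        using elim(1) unfolding norm_mult by (intro mult_left_mono) auto
    qed
    also have "\<dots> = (\<Sum>r\<in>P. norm (e N p r)) * (2 * Y N)" by (simp add: sum_distrib_right)
    also have "\<dots> \<le> \<epsilon> N * (2 * Y N)"
    proof (rule mult_right_mono)
      show "(\<Sum>r\<in>P. norm (e N p r)) \<le> \<epsilon> N"
        unfolding \<epsilon>_def using fin p by (intro member_le_sum) (auto intro: sum_nonneg)
      show "0 \<le> 2 * Y N" by (simp add: Y_def sum_nonneg)
    qed
    finally show ?case .
  qed
  have "(\<lambda>N. \<epsilon> N * (2 * Y N)) \<longlonglongrightarrow> 0 * (2 * (\<Sum>p\<in>P. norm (l p)))"
    by (intro tendsto_intros \<epsilon> Y)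
  then have "(\<lambda>N. x N p - y N p) \<longlonglongrightarrow> 0"
    using Lim_null_comparison[OF bound] by simp
  from tendsto_add[OF this y[OF p]] show ?thesis by simp
qed

section \<open>Limits of cumulants, moments and products\<close>

lemma eventually_ge_one: "\<forall>\<^sub>F N in sequentially. (1::nat) \<le> N"
  by (rule eventually_ge_at_top)

text \<open>Applying the inverse of the limiting matrix to the moments recovers the cumulants up to
  vanishing coefficients times the cumulants themselves. It also shows that
  \<open>lim_cumulant\<close> is a genuine limit.\<close>

lemma cumulant_tendsto:
  assumes "converges_in_moments k E" "p \<in> Parts k"
  shows "(\<lambda>N. cumulant k N p (E N)) \<longlonglongrightarrow> lim_cumulant k E p"
proof -
  define \<zeta> :: "diagram \<Rightarrow> diagram \<Rightarrow> complex" where "\<zeta> q p = (if order_defect k q p = 0 then 1 else 0)" for q p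
  obtain \<mu> where \<mu>: "\<And>x p. p \<in> Parts k \<Longrightarrow> x p = (\<Sum>q\<in>Parts k. \<mu> p q * (\<Sum>r\<in>Parts k. \<zeta> r q * x r))"
    using cumulant_left_inverse[of \<zeta> k] \<zeta>_def by blast
  define x where "x N p = cumulant k N p (E N)" for N p
  define m where "m N q = moment k N q (E N)" for N q
  \<comment> \<open>The limiting inverse applied to the difference between the matrix at N and its
    limit.\<close>
  define e where "e N p r = (\<Sum>q\<in>Parts k. \<mu> p q * (1 / of_nat N ^ order_defect k r q - \<zeta> r q))" for N p r
  have "(\<lambda>N. x N p) \<longlonglongrightarrow> (\<Sum>q\<in>Parts k. \<mu> p q * lim_moment k E q)"
  proof (rule tendsto_perturbed[of "Parts k" x "\<lambda>N p. \<Sum>q\<in>Parts k. \<mu> p q * m N q" e])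
    show "\<forall>\<^sub>F N in sequentially. \<forall>p\<in>Parts k. x N p =
        (\<Sum>q\<in>Parts k. \<mu> p q * m N q) - (\<Sum>r\<in>Parts k. e N p r * x N r)"
      using eventually_ge_one
    proof eventually_elim
      case (elim N)
      show ?case
      proof
        fix p assume "p \<in> Parts k"
        have "(\<Sum>r\<in>Parts k. e N p r * x N r) = (\<Sum>r\<in>Parts k. \<Sum>q\<in>Parts k.
            \<mu> p q * (x N r / of_nat N ^ order_defect k r q) - \<mu> p q * (\<zeta> r q * x N r))"
          unfolding e_def sum_distrib_right
          by (intro sum.cong refl) (simp add: left_diff_distrib right_diff_distrib mult_ac)
        also have "\<dots> = (\<Sum>q\<in>Parts k. \<mu> p q * (\<Sum>r\<in>Parts k. x N r / of_nat N ^ order_defect k r q))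
            - (\<Sum>q\<in>Parts k. \<mu> p q * (\<Sum>r\<in>Parts k. \<zeta> r q * x N r))"
          by (subst sum.swap) (simp add: sum_subtractf sum_distrib_left)
        also have "\<dots> = (\<Sum>q\<in>Parts k. \<mu> p q * m N q) - x N p"
          using \<mu>[OF \<open>p \<in> Parts k\<close>, of "x N"] elim by (simp add: m_def x_def moment_eq_cumulants)
        finally show "x N p = (\<Sum>q\<in>Parts k. \<mu> p q * m N q) - (\<Sum>r\<in>Parts k. e N p r * x N r)" by simp
      qed
    qed
    show "(\<lambda>N. e N p r) \<longlonglongrightarrow> 0" for p r
      unfolding e_def \<zeta>_def
      by (intro tendsto_null_sum tendsto_mult_right_zero LIM_zero tendsto_inverse_power_of_nat)
    show "(\<lambda>N. \<Sum>q\<in>Parts k. \<mu> p q * m N q) \<longlonglongrightarrow> (\<Sum>q\<in>Parts k. \<mu> p q * lim_moment k E q)" for p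
      using assms(1) unfolding m_def lim_moment_def converges_in_moments_def
      by (intro tendsto_sum tendsto_mult_left) (simp add: convergent_LIMSEQ_iff)
  qed (use assms in auto)
  then show ?thesis unfolding lim_cumulant_def x_def by (simp add: limI)
qed

lemma tendsto_moment:
  assumes "\<And>q. q \<in> Parts k \<Longrightarrow> (\<lambda>N. cumulant k N q (E N)) \<longlonglongrightarrow> c q" "p \<in> Parts k"
  shows "(\<lambda>N. moment k N p (E N)) \<longlonglongrightarrow>
    (\<Sum>q\<in>Parts k. c q * (if order_defect k q p = 0 then 1 else 0))"
proof -
  have "(\<lambda>N. \<Sum>q\<in>Parts k. cumulant k N q (E N) * (1 / of_nat N ^ order_defect k q p)) \<longlonglongrightarrow>
      (\<Sum>q\<in>Parts k. c q * (if order_defect k q p = 0 then 1 else 0))"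
    using assms(1) by (intro tendsto_intros tendsto_inverse_power_of_nat)
  then show ?thesis
    by (rule Lim_transform_eventually)
      (use eventually_ge_one in eventually_elim, simp add: moment_eq_cumulants[OF assms(2)])
qed

lemma cumulant_mult_tendsto:
  assumes "\<And>p. p \<in> Parts k \<Longrightarrow> (\<lambda>N. cumulant k N p (E N)) \<longlonglongrightarrow> c p"
    and "\<And>p. p \<in> Parts k \<Longrightarrow> (\<lambda>N. cumulant k N p (F N)) \<longlonglongrightarrow> d p"
    and "p \<in> Parts k"
  shows "(\<lambda>N. cumulant k N p (palg_mult k N (E N) (F N))) \<longlonglongrightarrow> boxconv k c d p"
proof -
  have "(\<lambda>N. \<Sum>p1\<in>Parts k. \<Sum>p2\<in>Parts k. if compose k p1 p2 = p then cumulant k N p1 (E N)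
      * cumulant k N p2 (F N) * (1 / of_nat N ^ compose_defect k p1 p2) else 0) \<longlonglongrightarrow> boxconv k c d p"
    unfolding boxconv_eq
  proof (intro tendsto_sum)
    fix p1 p2 assume P: "p1 \<in> Parts k" "p2 \<in> Parts k"
    show "(\<lambda>N. if compose k p1 p2 = p then cumulant k N p1 (E N)
      * cumulant k N p2 (F N) * (1 / of_nat N ^ compose_defect k p1 p2) else 0) \<longlonglongrightarrow>
      (if compose k p1 p2 = p then c p1 * d p2 * (if compose_defect k p1 p2 = 0 then 1 else 0) else 0)"
    proof (cases "compose k p1 p2 = p")
      case True
      then show ?thesis
        using assms(1)[OF P(1)] assms(2)[OF P(2)] tendsto_inverse_power_of_nat
        by (simp only: simp_thms if_True) (intro tendsto_mult)
    qed simp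
  qed
  then show ?thesis
  proof (rule Lim_transform_eventually)
    show "\<forall>\<^sub>F N in sequentially. (\<Sum>p1\<in>Parts k. \<Sum>p2\<in>Parts k. if compose k p1 p2 = p then
        cumulant k N p1 (E N) * cumulant k N p2 (F N) * (1 / of_nat N ^ compose_defect k p1 p2) else 0)
      = cumulant k N p (palg_mult k N (E N) (F N))"
      using eventually_ge_one
      by eventually_elim (simp add: cumulant_palg_mult[OF assms(3)] cong: if_cong)
  qed
qed

lemma moment_mult_tendsto_left:
  assumes "\<And>p. p \<in> Parts k \<Longrightarrow> (\<lambda>N. cumulant k N p (E N)) \<longlonglongrightarrow> c p"
    and "\<And>p. p \<in> Parts k \<Longrightarrow> (\<lambda>N. moment k N p (F N)) \<longlonglongrightarrow> m p"
    and "p \<in> Parts k"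
  shows "(\<lambda>N. moment k N p (palg_mult k N (E N) (F N))) \<longlonglongrightarrow> boxconv_d k c m p"
proof -
  have "(\<lambda>N. \<Sum>p1\<in>Parts k. cumulant k N p1 (E N) * moment k N (compose k (transp p1) p) (F N)
      * (1 / of_nat N ^ order_defect k p1 p)) \<longlonglongrightarrow> boxconv_d k c m p"
    unfolding boxconv_d_eq[OF assms(3)]
    by (intro tendsto_sum tendsto_mult tendsto_inverse_power_of_nat assms(1,2) compose_in_Parts)
  then show ?thesis
    by (rule Lim_transform_eventually)
      (use eventually_ge_one in eventually_elim, simp add: moment_palg_mult_left[OF assms(3)])
qed

lemma moment_mult_tendsto_right:
  assumes "\<And>p. p \<in> Parts k \<Longrightarrow> (\<lambda>N. moment k N p (E N)) \<longlonglongrightarrow> m p"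
    and "\<And>p. p \<in> Parts k \<Longrightarrow> (\<lambda>N. cumulant k N p (F N)) \<longlonglongrightarrow> c p"
    and "p \<in> Parts k"
  shows "(\<lambda>N. moment k N p (palg_mult k N (E N) (F N))) \<longlonglongrightarrow> boxconv_g k m c p"
proof -
  have "(\<lambda>N. \<Sum>p2\<in>Parts k. moment k N (compose k p (transp p2)) (E N) * cumulant k N p2 (F N)
      * (1 / of_nat N ^ order_defect k p2 p)) \<longlonglongrightarrow> boxconv_g k m c p"
    unfolding boxconv_g_eq[OF assms(3)]
    by (intro tendsto_sum tendsto_mult tendsto_inverse_power_of_nat assms(1,2) compose_in_Parts)
  then show ?thesis
    by (rule Lim_transform_eventually)
      (use eventually_ge_one in eventually_elim, simp add: moment_palg_mult_right[OF assms(3)])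
qed

theorem theorem5p10:
  fixes k :: nat
    and E :: "real \<Rightarrow> nat \<Rightarrow> element"
    and H :: "nat \<Rightarrow> element"
  assumes "semigroup_with_generator k E H"
    and "converges_in_moments k (E 0)"
    and "converges_in_moments k H"
  shows "semigroup_converges k E \<and>
    (\<forall>t\<^sub>0\<ge>0.
       form_has_derivative k (\<lambda>t. lim_cumulant k (E t))
         (boxconv k (lim_cumulant k H) (lim_cumulant k (E t\<^sub>0))) t\<^sub>0 \<and>
       form_has_derivative k (\<lambda>t. lim_moment k (E t))
         (boxconv_d k (lim_cumulant k H) (lim_moment k (E t\<^sub>0))) t\<^sub>0 \<and>
       form_has_derivative k (\<lambda>t. lim_moment k (E t))
         (boxconv_g k (lim_moment k H) (lim_cumulant k (E t\<^sub>0))) t\<^sub>0)"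
proof -
  let ?P = "Parts k" and ?h = "lim_cumulant k H"
  \<comment> \<open>Left multiplication by the generator in cumulant coordinates. Its entries
    contain only nonpositive powers of N, hence converge to those of \<open>B\<close>.\<close>
  define A where "A N p p2 = (\<Sum>p1\<in>?P. if compose k p1 p2 = p
    then cumulant k N p1 (H N) * (1 / of_nat N ^ compose_defect k p1 p2) else 0)" for N p p2
  define B where "B p p2 = (\<Sum>p1\<in>?P. if compose k p1 p2 = p
    then ?h p1 * (if compose_defect k p1 p2 = 0 then 1 else 0) else 0)" for p p2
  define \<zeta> :: "diagram \<Rightarrow> diagram \<Rightarrow> complex" where "\<zeta> q p = (if order_defect k q p = 0 then 1 else 0)" for q p
  have B_eq: "(\<Sum>q\<in>?P. B p q * \<psi> q) = boxconv k ?h \<psi> p" for p \<psi>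
  proof -
    have "(\<Sum>q\<in>?P. B p q * \<psi> q) = (\<Sum>p2\<in>?P. \<Sum>p1\<in>?P. if compose k p1 p2 = p
        then ?h p1 * \<psi> p2 * (if compose_defect k p1 p2 = 0 then 1 else 0) else 0)"
      unfolding B_def sum_distrib_right by (intro sum.cong refl) auto
    then show ?thesis unfolding boxconv_eq by (subst (asm) sum.swap)
  qed
  have A_eq: "(\<Sum>q\<in>?P. A N p q * cumulant k N q F) = cumulant k N p (palg_mult k N (H N) F)"
    if "p \<in> ?P" "N \<ge> 1" for N p F
  proof -
    have "(\<Sum>q\<in>?P. A N p q * cumulant k N q F) = (\<Sum>p2\<in>?P. \<Sum>p1\<in>?P. if compose k p1 p2 = p
        then cumulant k N p1 (H N) * cumulant k N p2 F / of_nat N ^ compose_defect k p1 p2 else 0)"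
      unfolding A_def sum_distrib_right by (intro sum.cong refl) auto
    then show ?thesis unfolding cumulant_palg_mult[OF that] by (subst (asm) sum.swap)
  qed
  have A_lim: "(\<lambda>N. A N p q) \<longlonglongrightarrow> B p q" for p q
    unfolding A_def B_def
  proof (rule tendsto_sum)
    fix p1 assume "p1 \<in> ?P"
    then show "(\<lambda>N. if compose k p1 q = p then cumulant k N p1 (H N) * (1 / of_nat N ^ compose_defect k p1 q) else 0)
      \<longlonglongrightarrow> (if compose k p1 q = p then ?h p1 * (if compose_defect k p1 q = 0 then 1 else 0) else 0)"
      using tendsto_mult[OF cumulant_tendsto[OF assms(3)] tendsto_inverse_power_of_nat]
      by (cases "compose k p1 q = p") simp_all
  qed
  have ode: "((\<lambda>t. cumulant k N p (E t N)) has_vector_derivative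
      (\<Sum>q\<in>?P. A N p q * cumulant k N q (E t N))) (at t within {0..})"
    if "0 \<le> t" "p \<in> ?P" "N \<ge> 1" for N t p
  proof -
    have "((\<lambda>t. E t N p) has_vector_derivative palg_mult k N (H N) (E t N) p) (at t within {0..})"
      using assms(1) that by (simp add: semigroup_with_generator_def)
    then show ?thesis
      unfolding A_eq[OF that(2,3)] unfolding cumulant_def by (rule has_vector_derivative_mult_right)
  qed
  \<comment> \<open>The differential equation is given for N at least 1 only, so the sequences are
    shifted by one to start at a valid index.\<close>
  obtain y where y_lim: "\<And>t p. 0 \<le> t \<Longrightarrow> p \<in> ?P \<Longrightarrow> (\<lambda>N. cumulant k (Suc N) p (E t (Suc N))) \<longlonglongrightarrow> y t p"
    and y_ode: "\<And>t p. 0 \<le> t \<Longrightarrow> p \<in> ?P \<Longrightarrow>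
      ((\<lambda>t. y t p) has_vector_derivative (\<Sum>q\<in>?P. B p q * y t q)) (at t within {0..})"
  proof (rule linear_ode_limit[of ?P "\<lambda>N t p. cumulant k (Suc N) p (E t (Suc N))" "\<lambda>N. A (Suc N)" B])
    show "(\<lambda>N. cumulant k (Suc N) p (E 0 (Suc N))) \<longlonglongrightarrow> lim_cumulant k (E 0) p" if "p \<in> ?P" for p
      using LIMSEQ_Suc[OF cumulant_tendsto[OF assms(2) that]] .
  qed (use ode LIMSEQ_Suc[OF A_lim] in auto)
  have cum: "(\<lambda>N. cumulant k N p (E t N)) \<longlonglongrightarrow> y t p" if "0 \<le> t" "p \<in> ?P" for t p
    using y_lim[OF that] by (rule LIMSEQ_imp_Suc)
  then have lim_cum: "lim_cumulant k (E t) p = y t p" if "0 \<le> t" "p \<in> ?P" for t p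
    using that by (simp add: lim_cumulant_def limI)
  have mom: "(\<lambda>N. moment k N p (E t N)) \<longlonglongrightarrow> (\<Sum>q\<in>?P. y t q * \<zeta> q p)" if "0 \<le> t" "p \<in> ?P" for t p
    unfolding \<zeta>_def using that cum by (intro tendsto_moment) auto
  then have lim_mom: "lim_moment k (E t) p = (\<Sum>q\<in>?P. y t q * \<zeta> q p)" if "0 \<le> t" "p \<in> ?P" for t p
    using that by (simp add: lim_moment_def limI)
  have conv: "converges_in_moments k (E t)" if "0 \<le> t" for t
    unfolding converges_in_moments_def using mom[OF that] convergentI by blast
  have momL: "(\<lambda>N. moment k N p (F N)) \<longlonglongrightarrow> lim_moment k F p"
    if "converges_in_moments k F" "p \<in> ?P" for F p
    using that by (simp add: converges_in_moments_def lim_moment_def convergent_LIMSEQ_iff)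
  have der_cum: "form_has_derivative k (\<lambda>t. lim_cumulant k (E t))
      (boxconv k ?h (lim_cumulant k (E t0))) t0" if t0: "0 \<le> t0" for t0
    unfolding form_has_derivative_def
  proof
    fix p assume p: "p \<in> ?P"
    have "(\<Sum>q\<in>?P. B p q * y t0 q) = (\<Sum>q\<in>?P. B p q * lim_cumulant k (E t0) q)"
      by (rule sum.cong[OF refl]) (simp only: lim_cum[OF t0])
    also have "\<dots> = boxconv k ?h (lim_cumulant k (E t0)) p" by (rule B_eq)
    finally have "((\<lambda>t. y t p) has_vector_derivative
        boxconv k ?h (lim_cumulant k (E t0)) p) (at t0 within {0..})"
      using y_ode[OF t0 p] by simp
    \<comment> \<open>For negative times nothing is known about the limit; the one-sided filter sees
      only times where it equals \<open>y\<close>.\<close>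
    then show "((\<lambda>t. lim_cumulant k (E t) p) has_vector_derivative
        boxconv k ?h (lim_cumulant k (E t0)) p) (at t0 within {0..})"
      by (rule has_vector_derivative_transform[rotated 2]) (use t0 p lim_cum in auto)
  qed
  \<comment> \<open>Limiting moments are linear combinations of limiting cumulants with constant
    coefficients, so no second limit of derivatives is needed.\<close>
  have der_mom: "((\<lambda>t. lim_moment k (E t) p) has_vector_derivative
      (\<Sum>q\<in>?P. boxconv k ?h (lim_cumulant k (E t0)) q * \<zeta> q p)) (at t0 within {0..})"
    if t0: "0 \<le> t0" and p: "p \<in> ?P" for t0 p
  proof (rule has_vector_derivative_transform)
    show "((\<lambda>t. \<Sum>q\<in>?P. lim_cumulant k (E t) q * \<zeta> q p) has_vector_derivative
      (\<Sum>q\<in>?P. boxconv k ?h (lim_cumulant k (E t0)) q * \<zeta> q p)) (at t0 within {0..})"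
      using der_cum[OF t0] unfolding form_has_derivative_def
      by (intro has_vector_derivative_sum has_vector_derivative_mult_left) blast
    show "lim_moment k (E t) p = (\<Sum>q\<in>?P. lim_cumulant k (E t) q * \<zeta> q p)" if "t \<in> {0..}" for t
      using that p by (simp add: lim_mom lim_cum)
  qed (use t0 in simp)
  \<comment> \<open>First of three evaluations of one limit, through the cumulants of the product;
    those through left and right factors follow, and uniqueness of limits identifies the
    results.\<close>
  have mult: "(\<lambda>N. moment k N p (palg_mult k N (H N) (E t0 N))) \<longlonglongrightarrow>
      (\<Sum>q\<in>?P. boxconv k ?h (lim_cumulant k (E t0)) q * \<zeta> q p)" if "0 \<le> t0" "p \<in> ?P" for t0 p
    unfolding \<zeta>_def using that assms(3) conv
    by (intro tendsto_moment cumulant_mult_tendsto cumulant_tendsto)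
  have d: "(\<Sum>q\<in>?P. boxconv k ?h (lim_cumulant k (E t0)) q * \<zeta> q p)
      = boxconv_d k ?h (lim_moment k (E t0)) p" if "0 \<le> t0" "p \<in> ?P" for t0 p
    using mult[OF that]
      moment_mult_tendsto_left[OF cumulant_tendsto[OF assms(3)] momL[OF conv[OF that(1)]] that(2)]
    by (rule LIMSEQ_unique)
  have g: "(\<Sum>q\<in>?P. boxconv k ?h (lim_cumulant k (E t0)) q * \<zeta> q p)
      = boxconv_g k (lim_moment k H) (lim_cumulant k (E t0)) p" if "0 \<le> t0" "p \<in> ?P" for t0 p
    using mult[OF that]
      moment_mult_tendsto_right[OF momL[OF assms(3)] cumulant_tendsto[OF conv[OF that(1)]] that(2)]
    by (rule LIMSEQ_unique)
  have der_d: "form_has_derivative k (\<lambda>t. lim_moment k (E t)) (boxconv_d k ?h (lim_moment k (E t0))) t0"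
    and der_g: "form_has_derivative k (\<lambda>t. lim_moment k (E t))
      (boxconv_g k (lim_moment k H) (lim_cumulant k (E t0))) t0" if t0: "0 \<le> t0" for t0
    unfolding form_has_derivative_def
  proof safe
    fix p assume p: "p \<in> ?P"
    show "((\<lambda>t. lim_moment k (E t) p) has_vector_derivative
        boxconv_d k ?h (lim_moment k (E t0)) p) (at t0 within {0..})"
      unfolding d[OF t0 p, symmetric] by (rule der_mom[OF t0 p])
    show "((\<lambda>t. lim_moment k (E t) p) has_vector_derivative
        boxconv_g k (lim_moment k H) (lim_cumulant k (E t0)) p) (at t0 within {0..})"
      unfolding g[OF t0 p, symmetric] by (rule der_mom[OF t0 p])
  qed
  show ?thesis
    unfolding semigroup_converges_def by (intro conjI allI impI conv der_cum der_d der_g)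
qed

end
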